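(* Up to isomorphism, the prime split graphs $G$ with $\deg(G)=4$ are exactly the following 12 graphs: $$D_{4,1},\ \overline{D_{4,1}},\ D_{2,2},\ \overline{D_{2,2}},\ R_{311},\ \overline{R_{311}},\ R_{331},\ \overline{R_{331}},\ R_{211},\ \overline{R_{211}},\ R_{321},\ \overline{R_{321}}.$$
   Context: Graphs are finite and simple, with nonempty vertex set; $\overline{G}$ is the complement of $G$. A 2-switch on $G$: given four distinct vertices $a,b,x,y$ with $ab,xy\in E(G)$ and $ax,by\notin E(G)$, delete the edges $ab,xy$ and add the edges $ax,by$ (two 2-switches are equal iff they delete the same two edges and add the same two edges). The 2-switch-degree $\deg(G)$ is the number of distinct 2-switches that can be performed on $G$. A vertex is active in $G$ if it is one of the four vertices involved in some 2-switch on $G$; $G$ is active if all its vertices are active. A split graph is a graph whose vertex set can be partitioned into a clique $K$ and an independent set $I$ (either possibly empty); when such a bipartition is fixed one writes $(S,K,I)$. If $(S,K,I)$ is split and $G$ is a graph vertex-disjoint from $S$, the Tyshkevich composition $(S,K,I)\circ G$ has vertex set $V(S)\cup V(G)$ and edge set $E(S)\cup E(G)\cup\{xy: x\in K,\ y\in V(G)\}$. A graph $G$ is decomposable if $G=S\circ H$ for some $S,H$ with $|S|,|H|\ge1$, and indecomposable otherwise. A graph is prime if it is indecomposable and active. The named graphs (each split, given by clique $K$, independent set $I$, and neighborhoods of the vertices of $I$): - $D_{4,1}$: $K=\{1,2,3,4,5\}$, $I=\{a,b\}$, $N_a=\{1\}$, $N_b=\{2,3,4,5\}$. - $D_{2,2}$: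 $K=\{1,2,3,4\}$, $I=\{a,b\}$, $N_a=\{1,2\}$, $N_b=\{3,4\}$. - $R_{311}$: $K=\{1,2,3,4\}$, $I=\{a,b,c\}$, $N_a=\{1\}$, $N_b=\{2\}$, $N_c=\{1,3,4\}$. - $R_{331}$: $K=\{1,2,3,4\}$, $I=\{a,b,c\}$, $N_a=\{1\}$, $N_b=\{2,3,4\}$, $N_c=\{1,3,4\}$. - $R_{321}$: $K=\{1,2,3,4\}$, $I=\{a,b,c\}$, $N_a=\{1\}$, $N_b=\{2,3\}$, $N_c=\{1,3,4\}$. - $R_{211}$: $K=\{1,2,3\}$, $I=\{a,b,c\}$, $N_a=N_c=\{1\}$, $N_b=\{2,3\}$. *)

theory Defs
  imports Main
begin

record 'a sgraph =
  vertices :: "'a set"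
  edges :: "'a set set"

definition simple_graph :: "'a sgraph \<Rightarrow> bool" where
  "simple_graph G \<longleftrightarrow> finite (vertices G) \<and> vertices G \<noteq> {} \<and>
     edges G \<subseteq> {{u, v} | u v. u \<in> vertices G \<and> v \<in> vertices G \<and> u \<noteq> v}"

definition graph_complement :: "'a sgraph \<Rightarrow> 'a sgraph" where
  "graph_complement G = \<lparr> vertices = vertices G,
     edges = {{u, v} | u v. u \<in> vertices G \<and> v \<in> vertices G \<and> u \<noteq> v \<and> {u, v} \<notin> edges G} \<rparr>"

definition graph_iso :: "'a sgraph \<Rightarrow> 'b sgraph \<Rightarrow> bool" where
  "graph_iso G H \<longleftrightarrow> (\<exists>f. bij_betw f (vertices G) (vertices H) \<and>
     (\<forall>u \<in> vertices G. \<forall>v \<in> vertices G. {u, v} \<in> edges G \<longleftrightarrow> {f u, f v} \<in> edges H))"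

definition can_switch :: "'a sgraph \<Rightarrow> 'a \<Rightarrow> 'a \<Rightarrow> 'a \<Rightarrow> 'a \<Rightarrow> bool" where
  "can_switch G a b x y \<longleftrightarrow> {a, b, x, y} \<subseteq> vertices G \<and> distinct [a, b, x, y] \<and>
     {a, b} \<in> edges G \<and> {x, y} \<in> edges G \<and> {a, x} \<notin> edges G \<and> {b, y} \<notin> edges G"

text \<open>A 2-switch is identified with the pair (deleted edges, added edges), so that different
  labellings of the same switch are counted once.\<close>

definition two_switches :: "'a sgraph \<Rightarrow> ('a set set \<times> 'a set set) set" where
  "two_switches G = {({{a, b}, {x, y}}, {{a, x}, {b, y}}) | a b x y. can_switch G a b x y}"

definition switch_degree :: "'a sgraph \<Rightarrow> nat" where
  "switch_degree G = card (two_switches G)"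

definition active_vertex :: "'a sgraph \<Rightarrow> 'a \<Rightarrow> bool" where
  "active_vertex G v \<longleftrightarrow> (\<exists>a b x y. can_switch G a b x y \<and> v \<in> {a, b, x, y})"

definition active_graph :: "'a sgraph \<Rightarrow> bool" where
  "active_graph G \<longleftrightarrow> (\<forall>v \<in> vertices G. active_vertex G v)"

definition is_clique :: "'a sgraph \<Rightarrow> 'a set \<Rightarrow> bool" where
  "is_clique G K \<longleftrightarrow> K \<subseteq> vertices G \<and> (\<forall>u \<in> K. \<forall>v \<in> K. u \<noteq> v \<longrightarrow> {u, v} \<in> edges G)"

definition is_independent :: "'a sgraph \<Rightarrow> 'a set \<Rightarrow> bool" where
  "is_independent G I \<longleftrightarrow> I \<subseteq> vertices G \<and> (\<forall>u \<in> I. \<forall>v \<in> I. {u, v} \<notin> edges G)"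

definition split_bipartition :: "'a sgraph \<Rightarrow> 'a set \<Rightarrow> 'a set \<Rightarrow> bool" where
  "split_bipartition G K I \<longleftrightarrow>
     K \<union> I = vertices G \<and> K \<inter> I = {} \<and> is_clique G K \<and> is_independent G I"

definition split_graph :: "'a sgraph \<Rightarrow> bool" where
  "split_graph G \<longleftrightarrow> (\<exists>K I. split_bipartition G K I)"

text \<open>The composition of \<open>(S, K, I)\<close> with \<open>H\<close>; it does not depend on \<open>I\<close>, which is
  \<open>vertices S - K\<close>.\<close>

definition tyshkevich_comp :: "'a sgraph \<Rightarrow> 'a set \<Rightarrow> 'a sgraph \<Rightarrow> 'a sgraph" where
  "tyshkevich_comp S K H = \<lparr> vertices = vertices S \<union> vertices H,
     edges = edges S \<union> edges H \<union> {{x, y} | x y. x \<in> K \<and> y \<in> vertices H} \<rparr>"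

text \<open>Both factors have at least one vertex, since \<^const>\<open>simple_graph\<close> excludes the
  empty graph.\<close>

definition decomposable :: "'a sgraph \<Rightarrow> bool" where
  "decomposable G \<longleftrightarrow> (\<exists>S K I H. simple_graph S \<and> simple_graph H \<and>
     split_bipartition S K I \<and> vertices S \<inter> vertices H = {} \<and> G = tyshkevich_comp S K H)"

definition prime_graph :: "'a sgraph \<Rightarrow> bool" where
  "prime_graph G \<longleftrightarrow> \<not> decomposable G \<and> active_graph G"

text \<open>The split graph with clique \<open>{1, ..., n}\<close> (tagged \<^const>\<open>Inl\<close>) and one independent
  vertex (tagged \<^const>\<open>Inr\<close>) for each entry of \<open>Ns\<close>, that entry being its neighbourhood.
  The independent vertices \<open>a, b, c\<close> are \<open>Inr 0, Inr 1, Inr 2\<close>.\<close>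

definition split_from_nbhds :: "nat \<Rightarrow> nat set list \<Rightarrow> (nat + nat) sgraph" where
  "split_from_nbhds n Ns = \<lparr> vertices = Inl ` {1..n} \<union> Inr ` {..<length Ns},
     edges = {{Inl j, Inl k} | j k. j \<in> {1..n} \<and> k \<in> {1..n} \<and> j \<noteq> k}
           \<union> {{Inr i, Inl k} | i k. i < length Ns \<and> k \<in> Ns ! i} \<rparr>"

definition D41 :: "(nat + nat) sgraph" where
  "D41 = split_from_nbhds 5 [{1}, {2, 3, 4, 5}]"

definition D22 :: "(nat + nat) sgraph" where
  "D22 = split_from_nbhds 4 [{1, 2}, {3, 4}]"

definition R311 :: "(nat + nat) sgraph" where
  "R311 = split_from_nbhds 4 [{1}, {2}, {1, 3, 4}]"

definition R331 :: "(nat + nat) sgraph" where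
  "R331 = split_from_nbhds 4 [{1}, {2, 3, 4}, {1, 3, 4}]"

definition R321 :: "(nat + nat) sgraph" where
  "R321 = split_from_nbhds 4 [{1}, {2, 3}, {1, 3, 4}]"

definition R211 :: "(nat + nat) sgraph" where
  "R211 = split_from_nbhds 3 [{1}, {2, 3}, {1}]"

definition degree_four_graphs :: "(nat + nat) sgraph list" where
  "degree_four_graphs =
     [D41, graph_complement D41, D22, graph_complement D22,
      R311, graph_complement R311, R331, graph_complement R331,
      R211, graph_complement R211, R321, graph_complement R321]"

end

theory Submission
  imports Defs
begin

text \<open>
  Fix a split graph \<open>G\<close> with clique \<open>K\<close> and independent set \<open>I\<close>. Everything about 2-switches can be
  read off the family \<open>N\<close> of neighbourhoods \<open>N u \<subseteq> K\<close> of the vertices \<open>u \<in> I\<close>, called rows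
  below. A 2-switch removes two edges \<open>p u\<close>, \<open>q v\<close> with \<open>u, v \<in> I\<close>, \<open>p \<in> N u - N v\<close> and \<open>q \<in> N v - N u\<close>
  and adds \<open>p v\<close>, \<open>q u\<close>, so the degree of \<open>G\<close> is the
  sum of \<open>|N u - N v| * |N v - N u|\<close> over the unordered pairs \<open>u, v\<close> in \<open>I\<close>
  (\<open>split_switch_degree\<close>).

  Primality also has a description in terms of \<open>N\<close>. Call \<open>u\<close> and \<open>v\<close> incomparable if neither of \<open>N u\<close>,
  \<open>N v\<close> contains the other. A graph \<open>G\<close> is prime iff \<open>I\<close> has at least two elements, the incomparability
  graph on \<open>I\<close> is connected, and every \<open>k \<in> K\<close> lies in some but not all of the sets \<open>N u\<close>
  (\<open>prime_split_imp\<close>, \<open>linked_imp_prime_split\<close>). Indeed, a set of rows that is comparable with all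
  remaining rows can be refined to a bottom layer of rows contained in all others, and such a layer,
  with its neighbours, is a Tyshkevich factor; conversely, no 2-switch meets both factors of a composition.

  The key estimate is \<open>|I| + |K| \<le> deg G + 3\<close> for prime \<open>G\<close> (\<open>prime_split_order_bound\<close>). By connectedness
  \<open>I\<close> can be built up from an incomparable pair by adding one vertex at a time, each incomparable to
  an earlier one. Each addition separates some new elements of \<open>K\<close>, and these, together with the
  new vertex, are paid for by the new 2-switches (\<open>three_set_inequality\<close>).

  For degree 4 this gives at most 7 vertices, so one of \<open>I\<close>, \<open>K\<close> has at most three elements.
  Complementation exchanges \<open>K\<close> and \<open>I\<close> and preserves primality and degree, so suppose \<open>|I| \<le> 3\<close>. For
  two rows, \<open>K\<close> is the disjoint union of them and the product of their sizes is 4, which yields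
  \<open>D41\<close> and \<open>D22\<close>. For three rows, an incomparability triangle has weight different from 4
  (\<open>triangle_weight_ne_4\<close>), so one row is incomparable to the two others, which are nested; the sizes
  of the regions of the Venn diagram solve a small equation with five solutions, which are \<open>R331\<close>,
  \<open>R321\<close>, \<open>R311\<close>, \<open>R211\<close> and the complement of \<open>R211\<close>. Finally, the twelve graphs are told apart by
  their numbers of vertices and edges.
\<close>

section \<open>Families of sets and the incomparability graph\<close>

definition incomparable :: "('i \<Rightarrow> 'k set) \<Rightarrow> 'i \<Rightarrow> 'i \<Rightarrow> bool" where
  "incomparable N u v \<longleftrightarrow> \<not> N u \<subseteq> N v \<and> \<not> N v \<subseteq> N u"

text \<open>Connectedness of the incomparability graph on \<open>I\<close>, phrased through cuts: this is the form in which
  it fails for compositions and in which it is used to grow a subset of \<open>I\<close> one vertex at a time.\<close>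

definition linked :: "'i set \<Rightarrow> ('i \<Rightarrow> 'k set) \<Rightarrow> bool" where
  "linked I N \<longleftrightarrow> (\<forall>J. J \<noteq> {} \<and> J \<subset> I \<longrightarrow> (\<exists>u \<in> J. \<exists>v \<in> I - J. incomparable N u v))"

text \<open>In a split graph this is the number of 2-switches that involve the two independent vertices
  \<open>u\<close> and \<open>v\<close>.\<close>

definition crossing :: "('i \<Rightarrow> 'k set) \<Rightarrow> 'i \<Rightarrow> 'i \<Rightarrow> nat" where
  "crossing N u v = card (N u - N v) * card (N v - N u)"

definition separated :: "('i \<Rightarrow> 'k set) \<Rightarrow> 'i set \<Rightarrow> 'k set" where
  "separated N J = (\<Union>u\<in>J. N u) - (\<Inter>u\<in>J. N u)"

lemma incomparable_sym: "incomparable N u v \<Longrightarrow> incomparable N v u"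
  by (auto simp: incomparable_def)

lemma incomparable_irrefl [simp]: "\<not> incomparable N u u"
  by (auto simp: incomparable_def)

lemma crossing_sym: "crossing N u v = crossing N v u"
  by (simp add: crossing_def)

lemma crossing_self [simp]: "crossing N u u = 0"
  by (simp add: crossing_def)

lemma crossing_eq_0_iff:
  assumes "finite (N u)" "finite (N v)"
  shows "crossing N u v = 0 \<longleftrightarrow> \<not> incomparable N u v"
  using assms by (auto simp: crossing_def incomparable_def)

text \<open>A family that is not linked has a proper nonempty \<open>J\<close> without an incomparable pair across it. Let \<open>L\<close> be the side of this
  cut that contains an element \<open>m\<close> with \<open>N m\<close> of least size, and let \<open>C\<close> consist of the \<open>u \<in> L\<close> with
  \<open>N u\<close> below everything on the other side. Then \<open>m \<in> C\<close>, and an element of \<open>L - C\<close> lies above some set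
  of the other side, hence above everything in \<open>C\<close>.\<close>

lemma unlinked_layers:
  assumes fin: "finite I" "\<And>u. u \<in> I \<Longrightarrow> finite (N u)" and nl: "\<not> linked I N"
  obtains C where "C \<noteq> {}" "C \<subset> I" "\<And>u v. u \<in> C \<Longrightarrow> v \<in> I - C \<Longrightarrow> N u \<subseteq> N v"
proof -
  obtain J where J: "J \<noteq> {}" "J \<subset> I"
    and no: "\<forall>u \<in> J. \<forall>v \<in> I - J. \<not> incomparable N u v"
    using nl unfolding linked_def by metis
  have cmp: "N u \<subseteq> N v \<or> N v \<subseteq> N u" if "u \<in> J" "v \<in> I - J" for u v
    using bspec[OF bspec[OF no that(1)] that(2)] unfolding incomparable_def by metis
  have "I \<noteq> {}" using J by auto
  then obtain m where m: "m \<in> I" and min: "\<And>v. v \<in> I \<Longrightarrow> card (N m) \<le> card (N v)"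
    using ex_min_if_finite[of "(\<lambda>u. card (N u)) ` I"] fin(1)
    by (metis arg_min_if_finite(1) arg_min_least)
  obtain L where L: "m \<in> L" "L \<subset> I"
    and cmpL: "\<And>u v. u \<in> L \<Longrightarrow> v \<in> I - L \<Longrightarrow> N u \<subseteq> N v \<or> N v \<subseteq> N u"
  proof (cases "m \<in> J")
    case True
    then show ?thesis using that J cmp by blast
  next
    case False
    have "I - J \<subset> I" using J by auto
    moreover have "N u \<subseteq> N v \<or> N v \<subseteq> N u" if "u \<in> I - J" "v \<in> I - (I - J)" for u v
      using cmp[of v u] that by auto
    ultimately show ?thesis using that[of "I - J"] False m by blast
  qed
  define C where "C = {u \<in> L. \<forall>v \<in> I - L. N u \<subseteq> N v}"
  have "N m \<subseteq> N v" if "v \<in> I - L" for v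
    using cmpL[OF L(1) that] min[of v] fin(2)[OF m] that card_seteq[of "N m" "N v"] by auto
  then have "C \<noteq> {}" using L(1) unfolding C_def by auto
  moreover have "C \<subset> I" using L unfolding C_def by auto
  moreover have "N u \<subseteq> N v" if "u \<in> C" "v \<in> I - C" for u v
  proof (cases "v \<in> L")
    case True
    then obtain w where "w \<in> I - L" "\<not> N v \<subseteq> N w" using \<open>v \<in> I - C\<close> unfolding C_def by auto
    then show ?thesis using cmpL[OF True, of w] that(1) unfolding C_def by auto
  qed (use \<open>u \<in> C\<close> \<open>v \<in> I - C\<close> C_def in auto)
  ultimately show ?thesis using that by blast
qed

lemma linked_star:
  assumes "b \<in> I" "\<And>u. u \<in> I \<Longrightarrow> u \<noteq> b \<Longrightarrow> incomparable N b u"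
  shows "linked I N"
  unfolding linked_def
proof (intro allI impI)
  fix J assume J: "J \<noteq> {} \<and> J \<subset> I"
  show "\<exists>u\<in>J. \<exists>v\<in>I - J. incomparable N u v"
  proof (cases "b \<in> J")
    case True
    from J obtain v where "v \<in> I - J" by auto
    then show ?thesis using True assms(2)[of v] by auto
  next
    case False
    from J obtain u where "u \<in> J" by auto
    then show ?thesis using False assms J incomparable_sym[OF assms(2)[of u]] by blast
  qed
qed

text \<open>A linked family grows from an incomparable pair: applying the definition to the part reached so far
  provides the next vertex.\<close>

lemma linked_induct [consumes 3, case_names pair grow]:
  assumes "linked I N" "finite I" "2 \<le> card I"
    and pair: "\<And>u v. u \<in> I \<Longrightarrow> v \<in> I \<Longrightarrow> incomparable N u v \<Longrightarrow> P {u, v}"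
    and grow: "\<And>J u v. P J \<Longrightarrow> 2 \<le> card J \<Longrightarrow> J \<subseteq> I \<Longrightarrow> v \<in> J \<Longrightarrow> u \<in> I - J
      \<Longrightarrow> incomparable N u v \<Longrightarrow> P (insert u J)"
  shows "P I"
proof -
  have cross: "\<exists>u \<in> J. \<exists>v \<in> I - J. incomparable N u v" if "J \<noteq> {}" "J \<subset> I" for J
    using assms(1) that unfolding linked_def by blast
  have "\<exists>J \<subseteq> I. card J = k \<and> P J" if "2 \<le> k" "k \<le> card I" for k
    using that
  proof (induction k rule: dec_induct)
    case base
    obtain w where w: "w \<in> I" using assms(2,3) by fastforce
    moreover have "{w} \<noteq> I" using assms(3) by auto
    ultimately obtain u v where uv: "u \<in> {w}" "v \<in> I - {w}" "incomparable N u v"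
      using cross[of "{w}"] by auto
    have "card {u, v} = 2" using uv by auto
    moreover have "{u, v} \<subseteq> I" using uv w by auto
    moreover have "P {u, v}" using uv w by (intro pair) auto
    ultimately show ?case by blast
  next
    case (step k)
    then obtain J where J: "J \<subseteq> I" "card J = k" "P J" by auto
    have "J \<noteq> {}" "J \<subset> I" using J step by auto
    then obtain v u where uv: "v \<in> J" "u \<in> I - J" "incomparable N v u"
      using cross[of J] by auto
    have "P (insert u J)"
      using uv J step by (intro grow[of J v u] incomparable_sym[OF uv(3)]) auto
    moreover have "card (insert u J) = Suc k" "insert u J \<subseteq> I"
      using uv J finite_subset[OF J(1) assms(2)] by auto
    ultimately show ?case by blast
  qed
  then obtain J where "J \<subseteq> I" "card J = card I" "P J" using assms(3) by blast
  then show ?thesis using card_subset_eq[OF assms(2)] by auto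
qed

text \<open>If \<open>Z\<close> joins two incomparable sets \<open>X\<close>, \<open>Y\<close> and is incomparable to \<open>X\<close>, then the weight of \<open>Z\<close>
  against \<open>X\<close> and \<open>Y\<close> pays for \<open>Z\<close> itself and for the points on which \<open>X\<close> and \<open>Y\<close> agree
  and \<open>Z\<close> differs from both. In terms of the sizes of the regions of the Venn diagram this is
  \<open>1 + a + b \<le> (a + p) (b + r) + (a + q) (b + s)\<close>. As \<open>X\<close> and \<open>Y\<close> are incomparable, \<open>p + s\<close> and \<open>q + r\<close> are
  positive; as \<open>X\<close> and \<open>Z\<close> are, so are \<open>a + p\<close> and \<open>b + r\<close>. The claim
  follows by distinguishing which of \<open>p\<close> and \<open>r\<close> vanish.\<close>

lemma three_set_inequality:
  assumes fin: "finite X" "finite Y" "finite Z"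
    and XY: "\<not> X \<subseteq> Y" "\<not> Y \<subseteq> X" and XZ: "\<not> X \<subseteq> Z" "\<not> Z \<subseteq> X"
  shows "1 + card (X \<inter> Y - Z) + card (Z - (X \<union> Y))
    \<le> card (X - Z) * card (Z - X) + card (Y - Z) * card (Z - Y)"
proof -
  define a b p q r s where defs: "a = card (X \<inter> Y - Z)" "b = card (Z - (X \<union> Y))"
    "p = card (X - Y - Z)" "q = card (Y - X - Z)" "r = card (Y \<inter> Z - X)" "s = card (X \<inter> Z - Y)"
  have split: "card S = card T + card U" if "S = T \<union> U" "T \<inter> U = {}" "finite S"
    for S T U :: "'a set"
    using that by (simp add: card_Un_disjoint)
  have XmZ: "card (X - Z) = a + p" and ZmX: "card (Z - X) = b + r"
    and YmZ: "card (Y - Z) = a + q" and ZmY: "card (Z - Y) = b + s"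
    and XmY: "card (X - Y) = p + s" and YmX: "card (Y - X) = q + r"
    unfolding defs by (rule split; use fin in auto)+
  have pos: "0 < a + p" "0 < b + r" "0 < p + s" "0 < q + r"
    unfolding XmZ[symmetric] ZmX[symmetric] XmY[symmetric] YmX[symmetric]
    using XY XZ fin by (auto simp: card_gt_0_iff)
  have "1 + a + b \<le> (a + p) * (b + r) + (a + q) * (b + s)"
  proof (cases "p = 0")
    case True
    then obtain a' s' where as: "a = Suc a'" "s = Suc s'"
      using pos by (metis add.right_neutral add_0 gr0_implies_Suc)
    show ?thesis
    proof (cases "r = 0")
      case True
      then obtain b' q' where "b = Suc b'" "q = Suc q'"
        using pos by (metis add.right_neutral gr0_implies_Suc)
      then show ?thesis using as by (simp add: algebra_simps)
    next
      case False
      then obtain r' where "r = Suc r'" by (metis not0_implies_Suc)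
      then show ?thesis using as by (simp add: algebra_simps)
    qed
  next
    case False
    then obtain p' where p: "p = Suc p'" by (metis not0_implies_Suc)
    show ?thesis
    proof (cases "r = 0")
      case True
      then obtain b' q' where "b = Suc b'" "q = Suc q'"
        using pos by (metis add.right_neutral gr0_implies_Suc)
      then show ?thesis using p by (simp add: algebra_simps)
    next
      case False
      then obtain r' where "r = Suc r'" by (metis not0_implies_Suc)
      then show ?thesis using p by (simp add: algebra_simps)
    qed
  qed
  then show ?thesis unfolding XmZ ZmX YmZ ZmY by (simp add: defs)
qed

text \<open>The neighbour \<open>j\<close> of \<open>u\<close> and a partner \<open>l\<close> of \<open>j\<close> suffice: the points newly separated by \<open>u\<close> are in
  particular not separated by \<open>j\<close> and \<open>l\<close>.\<close>

lemma growth_inequality: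
  assumes fin: "finite J" "\<And>j. j \<in> J \<Longrightarrow> finite (N j)" "finite (N u)"
    and jl: "j \<in> J" "l \<in> J" "incomparable N j l" and uj: "incomparable N u j"
  shows "1 + card ((\<Inter>i\<in>J. N i) - N u) + card (N u - (\<Union>i\<in>J. N i))
    \<le> (\<Sum>i\<in>J. crossing N u i)"
proof -
  have "card ((\<Inter>i\<in>J. N i) - N u) \<le> card (N j \<inter> N l - N u)"
    "card (N u - (\<Union>i\<in>J. N i)) \<le> card (N u - (N j \<union> N l))"
    using jl fin by (auto intro!: card_mono)
  moreover have "1 + card (N j \<inter> N l - N u) + card (N u - (N j \<union> N l))
      \<le> crossing N u j + crossing N u l"
    using three_set_inequality[of "N j" "N l" "N u"] jl uj fin
    by (simp add: crossing_def incomparable_def mult.commute)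
  moreover have "crossing N u j + crossing N u l = (\<Sum>i\<in>{j, l}. crossing N u i)"
    using jl by (subst sum.insert) auto
  moreover have "\<dots> \<le> (\<Sum>i\<in>J. crossing N u i)"
    by (rule sum_mono2) (use jl fin in auto)
  ultimately show ?thesis by linarith
qed

text \<open>The sum counts every pair twice, so for a prime split graph this says \<open>|I| + |K| \<le> deg + 3\<close>. An
  incomparable pair with differences of sizes \<open>m, n \<ge> 1\<close> satisfies it because
  \<open>2 + m + n \<le> m n + 3\<close>, and adding a vertex preserves it by the previous inequality. The induction
  also carries along that every element has an incomparable partner, since that inequality asks for
  a partner of the vertex to which the new one is attached.\<close>

lemma linked_order_bound:
  assumes "linked I N" "finite I" "2 \<le> card I" and finN: "\<And>u. u \<in> I \<Longrightarrow> finite (N u)"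
  shows "2 * (card I + card (separated N I)) \<le> (\<Sum>u\<in>I. \<Sum>v\<in>I. crossing N u v) + 6"
proof -
  let ?P = "\<lambda>J. (\<forall>j\<in>J. \<exists>l\<in>J. incomparable N j l) \<and>
    2 * (card J + card (separated N J)) \<le> (\<Sum>u\<in>J. \<Sum>v\<in>J. crossing N u v) + 6"
  have "?P I"
    using assms(1-3)
  proof (induction rule: linked_induct)
    case (pair u v)
    have "u \<noteq> v" using pair by auto
    have "separated N {u, v} = (N u - N v) \<union> (N v - N u)" by (auto simp: separated_def)
    then have sep: "card (separated N {u, v}) = card (N u - N v) + card (N v - N u)"
      using finN pair by (simp only:) (subst card_Un_disjoint; auto)
    have "0 < card (N u - N v)" "0 < card (N v - N u)"
      using pair finN by (auto simp: incomparable_def card_gt_0_iff)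
    then obtain m n where "card (N u - N v) = Suc m" "card (N v - N u) = Suc n"
      by (metis gr0_implies_Suc)
    then have "card (N u - N v) + card (N v - N u) \<le> crossing N u v + 1"
      by (simp add: crossing_def)
    moreover have "(\<Sum>x\<in>{u, v}. \<Sum>y\<in>{u, v}. crossing N x y) = 2 * crossing N u v"
      using \<open>u \<noteq> v\<close> by (simp add: crossing_sym[of N v u])
    moreover have "card {u, v} = 2" using \<open>u \<noteq> v\<close> by simp
    ultimately have bound: "2 * (card {u, v} + card (separated N {u, v}))
        \<le> (\<Sum>x\<in>{u, v}. \<Sum>y\<in>{u, v}. crossing N x y) + 6"
      unfolding sep by simp
    then show ?case using pair(3) incomparable_sym[OF pair(3)] by blast
  next
    case (grow J u v)
    let ?A = "(\<Inter>i\<in>J. N i) - N u" and ?B = "N u - (\<Union>i\<in>J. N i)"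
    have finJ: "finite J" using grow assms(2) finite_subset by blast
    obtain l where l: "l \<in> J" "incomparable N v l" using grow by blast
    have weight: "1 + card ?A + card ?B \<le> (\<Sum>i\<in>J. crossing N u i)"
      using growth_inequality[OF finJ _ _ grow(4) l grow(6)] finN grow by auto
    have points: "card (separated N (insert u J)) \<le> card (separated N J) + card ?A + card ?B"
    proof -
      have "separated N (insert u J) \<subseteq> separated N J \<union> ?A \<union> ?B"
        by (auto simp: separated_def)
      moreover have "finite (separated N J \<union> ?A \<union> ?B)"
        using grow finN finJ by (auto simp: separated_def)
      ultimately have "card (separated N (insert u J)) \<le> card (separated N J \<union> ?A \<union> ?B)"
        by (rule card_mono[rotated])
      also have "\<dots> \<le> card (separated N J) + card ?A + card ?B"
        by (metis (no_types, lifting) add_le_mono1 card_Un_le le_trans)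
      finally show ?thesis .
    qed
    have total: "(\<Sum>x\<in>insert u J. \<Sum>y\<in>insert u J. crossing N x y)
        = (\<Sum>x\<in>J. \<Sum>y\<in>J. crossing N x y) + 2 * (\<Sum>i\<in>J. crossing N u i)"
    proof -
      have row: "(\<Sum>y\<in>insert u J. crossing N x y) = crossing N x u + (\<Sum>y\<in>J. crossing N x y)" for x
        using grow(5) finJ by (intro sum.insert) auto
      have "(\<Sum>x\<in>J. crossing N x u) = (\<Sum>i\<in>J. crossing N u i)"
        by (rule sum.cong[OF refl crossing_sym])
      moreover have "u \<notin> J" using grow(5) by simp
      ultimately show ?thesis
        using finJ by (simp add: row sum.distrib)
    qed
    have IH: "2 * (card J + card (separated N J)) \<le> (\<Sum>x\<in>J. \<Sum>y\<in>J. crossing N x y) + 6"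
      using grow(1) by blast
    have "2 * (card (insert u J) + card (separated N (insert u J)))
        \<le> 2 * (card J + card (separated N J)) + 2 * (1 + card ?A + card ?B)"
      using points grow(5) finJ by simp
    also have "\<dots> \<le> (\<Sum>x\<in>J. \<Sum>y\<in>J. crossing N x y) + 6 + 2 * (\<Sum>i\<in>J. crossing N u i)"
      by (intro add_mono mult_le_mono2 IH weight)
    also have "\<dots> = (\<Sum>x\<in>insert u J. \<Sum>y\<in>insert u J. crossing N x y) + 6"
      unfolding total by simp
    finally show ?case using grow by blast
  qed
  then show ?thesis by (rule conjunct2)
qed

section \<open>Two-switches of a split graph\<close>

definition nbhd :: "'a sgraph \<Rightarrow> 'a \<Rightarrow> 'a set" where
  "nbhd G v = {w. {v, w} \<in> edges G}"

lemma no_loop: "simple_graph G \<Longrightarrow> {v} \<notin> edges G"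
  by (auto simp: simple_graph_def doubleton_eq_iff)

lemma nbhd_subset_vertices: "simple_graph G \<Longrightarrow> nbhd G v \<subseteq> vertices G"
  by (auto simp: simple_graph_def nbhd_def doubleton_eq_iff)

lemma split_nbhd_subset:
  assumes "simple_graph G" "split_bipartition G K I" "u \<in> I"
  shows "nbhd G u \<subseteq> K"
  using nbhd_subset_vertices[OF assms(1), of u] assms(2,3)
  by (auto simp: split_bipartition_def is_independent_def nbhd_def)

lemma split_finite:
  assumes "simple_graph G" "split_bipartition G K I"
  shows "finite K" "finite I" "u \<in> I \<Longrightarrow> finite (nbhd G u)"
proof -
  have "finite (K \<union> I)" using assms by (simp add: simple_graph_def split_bipartition_def)
  then show "finite K" "finite I" by auto
  then show "finite (nbhd G u)" if "u \<in> I"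
    using split_nbhd_subset[OF assms that] finite_subset by blast
qed

text \<open>A 2-switch alternates between edges and non-edges around a 4-cycle \<open>a b y x\<close>. As edges do not join
  two vertices of \<open>I\<close> and non-edges do not join two vertices of \<open>K\<close>, the side of one vertex determines
  the sides of the others; the two alternatives correspond to \<open>a \<in> K\<close> and \<open>a \<in> I\<close>.\<close>

lemma split_can_switch_iff:
  assumes "simple_graph G" "split_bipartition G K I"
  shows "can_switch G a b x y \<longleftrightarrow>
    (b \<in> I \<and> x \<in> I \<and> a \<in> nbhd G b - nbhd G x \<and> y \<in> nbhd G x - nbhd G b) \<or>
    (a \<in> I \<and> y \<in> I \<and> b \<in> nbhd G a - nbhd G y \<and> x \<in> nbhd G y - nbhd G a)"
    (is "?L \<longleftrightarrow> ?R")
proof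
  assume L: ?L
  have adj: "{u, v} \<in> edges G" if "u \<in> K" "v \<in> K" "u \<noteq> v" for u v
    using that assms(2) by (auto simp: split_bipartition_def is_clique_def)
  have nadj: "{u, v} \<notin> edges G" if "u \<in> I" "v \<in> I" for u v
    using that assms(2) by (auto simp: split_bipartition_def is_independent_def)
  have side: "(v \<in> K) = (v \<notin> I)" if "v \<in> vertices G" for v
    using that assms(2) by (auto simp: split_bipartition_def)
  show ?R
    using L side[of a] side[of b] side[of x] side[of y] adj[of a x] adj[of b y]
      nadj[of a b] nadj[of x y]
    by (auto simp: can_switch_def nbhd_def insert_commute)
next
  assume R: ?R
  have mem: "v \<in> vertices G \<and> v \<in> K \<and> v \<notin> I" if "u \<in> I" "v \<in> nbhd G u" for u v
    using split_nbhd_subset[OF assms that(1)] that assms(2)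
    by (auto simp: split_bipartition_def)
  have memI: "u \<in> vertices G" if "u \<in> I" for u
    using that assms(2) by (auto simp: split_bipartition_def)
  from R show ?L
  proof
    assume A: "b \<in> I \<and> x \<in> I \<and> a \<in> nbhd G b - nbhd G x \<and> y \<in> nbhd G x - nbhd G b"
    then have "a \<noteq> y" "b \<noteq> x" by auto
    then show ?L using A mem[of b a] mem[of x y] memI[of b] memI[of x]
      by (auto simp: can_switch_def nbhd_def insert_commute)
  next
    assume A: "a \<in> I \<and> y \<in> I \<and> b \<in> nbhd G a - nbhd G y \<and> x \<in> nbhd G y - nbhd G a"
    then have "b \<noteq> x" "a \<noteq> y" by auto
    then show ?L using A mem[of a b] mem[of y x] memI[of a] memI[of y]
      by (auto simp: can_switch_def nbhd_def insert_commute)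
  qed
qed

lemma card_two_to_one:
  assumes "finite A" "\<And>x. x \<in> A \<Longrightarrow> card {y \<in> A. f y = f x} = 2"
  shows "card A = 2 * card (f ` A)"
proof -
  have "card A = (\<Sum>z\<in>f ` A. card {y \<in> A. f y = z})"
    using sum.image_gen[OF assms(1), of "\<lambda>_. 1::nat" f] by simp
  also have "\<dots> = (\<Sum>z\<in>f ` A. 2)" using assms(2) by (intro sum.cong) auto
  finally show ?thesis by simp
qed

text \<open>The tuples \<open>(u, v, p, q)\<close> with \<open>p \<in> N u - N v\<close> and \<open>q \<in> N v - N u\<close> cover each 2-switch exactly twice,
  by \<open>(u, v, p, q)\<close> and \<open>(v, u, q, p)\<close>. Ordered pairs are used because \<open>I\<close> carries no order that
  would single out one of the two.\<close>

theorem split_switch_degree: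
  assumes "simple_graph G" "split_bipartition G K I"
  shows "2 * switch_degree G = (\<Sum>u\<in>I. \<Sum>v\<in>I. crossing (nbhd G) u v)"
proof -
  let ?N = "nbhd G"
  define Q where "Q = (SIGMA u:I. SIGMA v:I. (?N u - ?N v) \<times> (?N v - ?N u))"
  define f :: "_ \<Rightarrow> 'a set set \<times> 'a set set" where
    "f = (\<lambda>(u, v, p, q). ({{u, p}, {v, q}}, {{v, p}, {u, q}}))"
  have mem: "(u, v, p, q) \<in> Q \<longleftrightarrow>
      u \<in> I \<and> v \<in> I \<and> p \<in> ?N u - ?N v \<and> q \<in> ?N v - ?N u" for u v p q
    by (auto simp: Q_def)
  have notI: "p \<notin> I" if "u \<in> I" "p \<in> ?N u" for u p
    using split_nbhd_subset[OF assms that(1)] that assms(2)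
    by (auto simp: split_bipartition_def)
  have "finite Q" unfolding Q_def using split_finite[OF assms] by auto
  moreover have "card {z \<in> Q. f z = f w} = 2" if "w \<in> Q" for w
  proof -
    obtain u v p q where w: "w = (u, v, p, q)" by (cases w)
    have Q: "u \<in> I" "v \<in> I" "p \<in> ?N u" "p \<notin> ?N v" "q \<in> ?N v" "q \<notin> ?N u"
      using that by (auto simp: w mem)
    have "{z \<in> Q. f z = f w} = {(u, v, p, q), (v, u, q, p)}"
    proof (intro equalityI subsetI)
      fix z assume "z \<in> {z \<in> Q. f z = f w}"
      then obtain u' v' p' q' where z: "z = (u', v', p', q')" "z \<in> Q" "f z = f w"
        by (cases z) auto
      have "u' \<in> I" "v' \<in> I" "p' \<notin> I" "q' \<notin> I" "p \<notin> I" "q \<notin> I"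
        using z Q notI by (auto simp: mem)
      moreover have "{{u', p'}, {v', q'}} = {{u, p}, {v, q}}" using z by (simp add: f_def w)
      ultimately show "z \<in> {(u, v, p, q), (v, u, q, p)}"
        using Q(1,2) unfolding z(1) doubleton_eq_iff by auto
    next
      fix z assume "z \<in> {(u, v, p, q), (v, u, q, p)}"
      then show "z \<in> {z \<in> Q. f z = f w}"
        using Q by (auto simp: mem w f_def insert_commute)
    qed
    moreover have "u \<noteq> v" using Q by auto
    ultimately show ?thesis by simp
  qed
  ultimately have "card Q = 2 * card (f ` Q)" by (rule card_two_to_one)
  moreover have "f ` Q = two_switches G"
  proof (intro equalityI subsetI)
    fix t assume "t \<in> f ` Q"
    then obtain u v p q where t: "t = f (u, v, p, q)" "(u, v, p, q) \<in> Q" by auto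
    then have "can_switch G p u v q"
      unfolding split_can_switch_iff[OF assms] mem by blast
    moreover have "t = ({{p, u}, {v, q}}, {{p, v}, {u, q}})"
      by (simp add: t f_def insert_commute)
    ultimately show "t \<in> two_switches G" unfolding two_switches_def by blast
  next
    fix t assume "t \<in> two_switches G"
    then obtain a b x y where t: "t = ({{a, b}, {x, y}}, {{a, x}, {b, y}})"
      and "can_switch G a b x y" by (auto simp: two_switches_def)
    then have "(b, x, a, y) \<in> Q \<or> (a, y, b, x) \<in> Q"
      unfolding split_can_switch_iff[OF assms] mem by blast
    moreover have "t = f (b, x, a, y)" "t = f (a, y, b, x)"
      unfolding t f_def by (simp_all add: insert_commute)
    ultimately show "t \<in> f ` Q" by (metis imageI)
  qed
  moreover have "card Q = (\<Sum>u\<in>I. \<Sum>v\<in>I. crossing ?N u v)"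
    unfolding Q_def using split_finite[OF assms]
    by (simp add: card_SigmaI crossing_def card_cartesian_product)
  ultimately show ?thesis by (simp add: switch_degree_def)
qed

section \<open>Tyshkevich decompositions and primality\<close>

text \<open>A Tyshkevich composition seen from inside \<open>G\<close>: the first factor is induced on \<open>K \<union> I\<close>, the second on
  \<open>W\<close>. In this form complementation exchanges \<open>K\<close> and \<open>I\<close>, and isomorphisms act by images.\<close>

definition tyshkevich_parts :: "'a sgraph \<Rightarrow> 'a set \<Rightarrow> 'a set \<Rightarrow> 'a set \<Rightarrow> bool" where
  "tyshkevich_parts G K I W \<longleftrightarrow>
     vertices G = K \<union> I \<union> W \<and> K \<inter> I = {} \<and> (K \<union> I) \<inter> W = {} \<and> K \<union> I \<noteq> {} \<and> W \<noteq> {} \<and>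
     is_clique G K \<and> is_independent G I \<and>
     (\<forall>w \<in> W. (\<forall>k \<in> K. {k, w} \<in> edges G) \<and> (\<forall>i \<in> I. {i, w} \<notin> edges G))"

definition induced_subgraph :: "'a sgraph \<Rightarrow> 'a set \<Rightarrow> 'a sgraph" where
  "induced_subgraph G X = \<lparr>vertices = X, edges = {e \<in> edges G. e \<subseteq> X}\<rparr>"

lemma simple_edgeE:
  assumes "simple_graph G" "e \<in> edges G"
  obtains u v where "e = {u, v}" "u \<in> vertices G" "v \<in> vertices G" "u \<noteq> v"
  using assms unfolding simple_graph_def by blast

lemma simple_induced_subgraph:
  assumes "simple_graph G" "X \<subseteq> vertices G" "X \<noteq> {}"
  shows "simple_graph (induced_subgraph G X)"
proof -
  have "\<exists>u v. e = {u, v} \<and> u \<in> X \<and> v \<in> X \<and> u \<noteq> v" if "e \<in> edges G" "e \<subseteq> X" for e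
    by (rule simple_edgeE[OF assms(1) that(1)]) (use that(2) in auto)
  then have "{e \<in> edges G. e \<subseteq> X} \<subseteq> {{u, v} |u v. u \<in> X \<and> v \<in> X \<and> u \<noteq> v}"
    by blast
  moreover have "finite X" using assms finite_subset by (auto simp: simple_graph_def)
  ultimately show ?thesis
    using assms(3) by (simp add: simple_graph_def induced_subgraph_def)
qed

lemma decomposable_iff:
  assumes G: "simple_graph G"
  shows "decomposable G \<longleftrightarrow> (\<exists>K I W. tyshkevich_parts G K I W)"
proof
  assume "decomposable G"
  then obtain S K I H where SH: "simple_graph S" "simple_graph H" "split_bipartition S K I"
    "vertices S \<inter> vertices H = {}" and comp: "G = tyshkevich_comp S K H"
    by (auto simp: decomposable_def)
  have vS: "vertices S = K \<union> I" "K \<inter> I = {}" using SH by (auto simp: split_bipartition_def)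
  have subS: "u \<in> vertices S \<and> v \<in> vertices S" if "{u, v} \<in> edges S" for u v
    using simple_edgeE[OF SH(1) that] by (auto simp: doubleton_eq_iff)
  have subH: "u \<in> vertices H \<and> v \<in> vertices H" if "{u, v} \<in> edges H" for u v
    using simple_edgeE[OF SH(2) that] by (auto simp: doubleton_eq_iff)
  have E: "{u, v} \<in> edges G \<longleftrightarrow> {u, v} \<in> edges S \<or> {u, v} \<in> edges H \<or>
      (u \<in> K \<and> v \<in> vertices H) \<or> (v \<in> K \<and> u \<in> vertices H)" for u v
    by (auto simp: comp tyshkevich_comp_def doubleton_eq_iff)
  have "is_clique G K"
    using SH(3) by (auto simp: E is_clique_def split_bipartition_def comp tyshkevich_comp_def)
  moreover have nonadj: "{u, v} \<notin> edges G" if "u \<in> I" "v \<in> I \<union> vertices H" for u v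
    using that SH(3,4) vS subS[of u v] subH[of u v]
    by (auto simp: E split_bipartition_def is_independent_def)
  moreover have V: "vertices G = K \<union> I \<union> vertices H"
    by (simp add: comp tyshkevich_comp_def vS)
  moreover have "is_independent G I" using nonadj V by (auto simp: is_independent_def)
  moreover have "{k, w} \<in> edges G" if "k \<in> K" "w \<in> vertices H" for k w
    using that by (simp add: E)
  moreover have "K \<union> I \<noteq> {}" "vertices H \<noteq> {}"
    using SH(1,2) vS by (auto simp: simple_graph_def)
  ultimately have "tyshkevich_parts G K I (vertices H)"
    using SH(4) vS unfolding tyshkevich_parts_def by simp
  then show "\<exists>K I W. tyshkevich_parts G K I W" by blast
next
  assume "\<exists>K I W. tyshkevich_parts G K I W"
  then obtain K I W where P: "tyshkevich_parts G K I W" by blast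
  let ?S = "induced_subgraph G (K \<union> I)" and ?H = "induced_subgraph G W"
  have "simple_graph ?S" "simple_graph ?H"
    using P by (auto intro!: simple_induced_subgraph[OF G] simp: tyshkevich_parts_def)
  moreover have "split_bipartition ?S K I"
    using P by (auto simp: tyshkevich_parts_def split_bipartition_def induced_subgraph_def
        is_clique_def is_independent_def)
  moreover have "vertices ?S \<inter> vertices ?H = {}"
    using P by (auto simp: tyshkevich_parts_def induced_subgraph_def)
  moreover have "G = tyshkevich_comp ?S K ?H"
  proof (rule sgraph.equality)
    have "e \<in> edges (tyshkevich_comp ?S K ?H)" if e: "e \<in> edges G" for e
    proof -
      obtain u v where uv: "e = {u, v}" "u \<in> vertices G" "v \<in> vertices G"
        using simple_edgeE[OF G e] by metis
      have "u \<notin> I \<or> v \<notin> W" "v \<notin> I \<or> u \<notin> W"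
        using P e by (auto simp: tyshkevich_parts_def uv(1) insert_commute)
      then show ?thesis
        using P e uv(2,3) unfolding uv(1)
        by (auto simp: tyshkevich_parts_def tyshkevich_comp_def induced_subgraph_def
            doubleton_eq_iff)
    qed
    moreover have "e \<in> edges G" if "e \<in> edges (tyshkevich_comp ?S K ?H)" for e
      using that P by (auto simp: tyshkevich_parts_def tyshkevich_comp_def induced_subgraph_def)
    ultimately show "edges G = edges (tyshkevich_comp ?S K ?H)" by blast
  qed (use P in \<open>auto simp: tyshkevich_parts_def tyshkevich_comp_def induced_subgraph_def\<close>)
  ultimately show "decomposable G" unfolding decomposable_def by blast
qed

lemma is_clique_mono: "is_clique G K \<Longrightarrow> A \<subseteq> K \<Longrightarrow> is_clique G A"
  by (simp add: is_clique_def subset_iff)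

lemma is_independent_mono: "is_independent G I \<Longrightarrow> A \<subseteq> I \<Longrightarrow> is_independent G A"
  by (simp add: is_independent_def subset_iff)

text \<open>If \<open>w \<in> W\<close> is an end of an edge, then the other end is not in \<open>I\<close>; if it is an end of a non-edge,
  then the other end is not in \<open>K\<close>. So in an alternating 4-cycle that meets \<open>W\<close> and leaves it at an
  edge, the next vertex is in \<open>K\<close>, from there a non-edge leads to \<open>I\<close>, and then an edge to \<open>K\<close> again; this
  last vertex would have to be joined to the vertex in \<open>W\<close> by a non-edge. Leaving at a non-edge is
  symmetric.\<close>

lemma switch_within_part:
  assumes P: "tyshkevich_parts G K I W" and sw: "can_switch G a b x y"
  shows "{a, b, x, y} \<subseteq> W \<or> {a, b, x, y} \<subseteq> K \<union> I"
proof -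
  have "vertices G = K \<union> I \<union> W" using P unfolding tyshkevich_parts_def by (elim conjE)
  moreover have "{a, b, x, y} \<subseteq> vertices G" using sw unfolding can_switch_def by (elim conjE)
  ultimately have V: "a \<in> W \<or> a \<in> K \<or> a \<in> I" "b \<in> W \<or> b \<in> K \<or> b \<in> I"
    "x \<in> W \<or> x \<in> K \<or> x \<in> I" "y \<in> W \<or> y \<in> K \<or> y \<in> I"
    by auto
  have cl: "is_clique G K" and ind: "is_independent G I"
    and join: "\<forall>w \<in> W. (\<forall>k \<in> K. {k, w} \<in> edges G) \<and> (\<forall>i \<in> I. {i, w} \<notin> edges G)"
    using P unfolding tyshkevich_parts_def by - (elim conjE, assumption)+
  have KK: "{u, v} \<in> edges G" if "u \<in> K" "v \<in> K" "u \<noteq> v" for u v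
    using cl that by (simp add: is_clique_def)
  have II: "{u, v} \<notin> edges G" if "u \<in> I" "v \<in> I" for u v
    using ind that by (simp add: is_independent_def)
  have KW: "{w, k} \<in> edges G" if "k \<in> K" "w \<in> W" for k w
    using join that by (subst insert_commute) blast
  have IW: "{w, i} \<notin> edges G" if "i \<in> I" "w \<in> W" for i w
    using join that by (subst insert_commute) blast
  have S: "{a, b} \<in> edges G" "{x, y} \<in> edges G" "{a, x} \<notin> edges G" "{b, y} \<notin> edges G"
    "a \<noteq> x" "b \<noteq> y" using sw by (auto simp: can_switch_def)
  have 1: "q \<notin> I" if "p \<in> W \<or> p \<in> I" "{p, q} \<in> edges G" for p q
    using that IW[of q p] II[of p q] by blast
  have 2: "q \<notin> K" if "p \<in> W \<or> p \<in> K" "{p, q} \<notin> edges G" "p \<noteq> q" for p q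
    using that KW[of q p] KK[of p q] by blast
  have S': "{b, a} \<in> edges G" "{y, x} \<in> edges G" "{x, a} \<notin> edges G" "{y, b} \<notin> edges G"
    using S by (simp_all add: insert_commute)
  note E = 1[OF _ S(1)] 1[OF _ S(2)] 1[OF _ S'(1)] 1[OF _ S'(2)]
    2[OF _ S(3) S(5)] 2[OF _ S(4) S(6)] 2[OF _ S'(3) S(5)[symmetric]] 2[OF _ S'(4) S(6)[symmetric]]
  show ?thesis using V E by blast
qed

text \<open>If the family were not linked, then its bottom layer \<open>C\<close> together with the union \<open>A\<close> of the
  neighbourhoods of \<open>C\<close> would induce a first factor: \<open>A\<close> is contained in the neighbourhoods of all
  other vertices of \<open>I\<close>, and \<open>C\<close> has no neighbours outside \<open>A\<close>. The other two properties only
  restate activity.\<close>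

lemma prime_split_imp:
  assumes G: "simple_graph G" and KI: "split_bipartition G K I" and prime: "prime_graph G"
  shows "2 \<le> card I" "separated (nbhd G) I = K" "linked I (nbhd G)"
proof -
  let ?N = "nbhd G"
  note [simp] = split_finite(1,2)[OF G KI]
  have NK: "?N u \<subseteq> K" if "u \<in> I" for u using split_nbhd_subset[OF G KI that] .
  have disj: "K \<inter> I = {}" "vertices G = K \<union> I" using KI by (auto simp: split_bipartition_def)
  have indec: "\<not> decomposable G" and act: "active_vertex G v" if "v \<in> vertices G" for v
    using prime that by (auto simp: prime_graph_def active_graph_def)
  have act: "\<exists>a b x y. can_switch G a b x y \<and> v \<in> {a, b, x, y}" if "v \<in> vertices G" for v
    using act[OF that] unfolding active_vertex_def .
  obtain v where v: "v \<in> vertices G" using G by (auto simp: simple_graph_def)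
  from act[OF v] obtain a b x y where "can_switch G a b x y" by blast
  then obtain s t where st: "s \<in> I" "t \<in> I" "s \<noteq> t"
    unfolding split_can_switch_iff[OF G KI] by blast
  then show "2 \<le> card I" using card_mono[of I "{s, t}"] by auto
  show "separated ?N I = K"
  proof (intro equalityI subsetI)
    fix k assume k: "k \<in> K"
    then have "k \<in> vertices G" using disj by simp
    from act[OF this] obtain a b x y where "can_switch G a b x y" "k \<in> {a, b, x, y}"
      by blast
    then obtain u v where "u \<in> I" "v \<in> I" "k \<in> ?N u - ?N v"
      unfolding split_can_switch_iff[OF G KI] using k disj by blast
    then show "k \<in> separated ?N I" by (auto simp: separated_def)
  qed (use NK in \<open>auto simp: separated_def\<close>)
  show "linked I ?N"
  proof (rule ccontr)
    assume "\<not> linked I ?N"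
    then obtain C where C: "C \<noteq> {}" "C \<subset> I"
      and layer: "\<And>u v. u \<in> C \<Longrightarrow> v \<in> I - C \<Longrightarrow> ?N u \<subseteq> ?N v"
      using unlinked_layers[of I ?N] split_finite[OF G KI] by metis
    define A W where "A = (\<Union>u\<in>C. ?N u)" and "W = vertices G - (A \<union> C)"
    have AK: "A \<subseteq> K" using C NK unfolding A_def by blast
    have low: "{k, w} \<in> edges G" if kw: "k \<in> A" "w \<in> W" for k w
    proof (cases "w \<in> I")
      case True
      then obtain u where "u \<in> C" "k \<in> ?N u" "w \<in> I - C" using kw by (auto simp: A_def W_def)
      then have "k \<in> ?N w" using layer by blast
      then show ?thesis by (simp add: nbhd_def insert_commute)
    next
      case False
      then have "w \<in> K" "k \<in> K" "k \<noteq> w" using kw disj AK by (auto simp: W_def)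
      then show ?thesis using KI by (auto simp: split_bipartition_def is_clique_def)
    qed
    have high: "{i, w} \<notin> edges G" if "i \<in> C" "w \<in> W" for i w
      using that by (auto simp: nbhd_def A_def W_def)
    have "is_clique G A" "is_independent G C"
      using KI is_clique_mono[OF _ AK] is_independent_mono[of G I C] C
      by (auto simp: split_bipartition_def)
    moreover have "vertices G = A \<union> C \<union> W" "A \<inter> C = {}" "(A \<union> C) \<inter> W = {}"
      using AK C disj by (auto simp: W_def)
    moreover have "W \<noteq> {}"
    proof -
      obtain i where "i \<in> I" "i \<notin> C" using C by blast
      then have "i \<in> W" using AK disj by (auto simp: W_def)
      then show ?thesis by blast
    qed
    ultimately have "tyshkevich_parts G A C W"
      unfolding tyshkevich_parts_def using low high C by simp
    then show False using indec[OF v] decomposable_iff[OF G] by blast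
  qed
qed

text \<open>An element \<open>k\<close> of \<open>K\<close> cuts \<open>I\<close> into the rows that contain \<open>k\<close> and those that do not; an incomparable
  pair across this cut gives a 2-switch through \<open>k\<close>. In a decomposition, 2-switches stay within a part,
  so linkedness puts all of \<open>I\<close> into one part, and the 2-switches through the elements of \<open>K\<close> put \<open>K\<close>
  into the same part.\<close>

lemma linked_imp_prime_split:
  assumes G: "simple_graph G" and KI: "split_bipartition G K I"
    and I: "2 \<le> card I" and sep: "separated (nbhd G) I = K" and linked: "linked I (nbhd G)"
  shows "prime_graph G"
proof -
  let ?N = "nbhd G"
  have disj: "K \<inter> I = {}" "vertices G = K \<union> I" using KI by (auto simp: split_bipartition_def)
  have cross: "\<exists>u v. u \<in> J \<and> v \<in> I - J \<and> incomparable ?N u v" if "J \<noteq> {}" "J \<subset> I" for J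
    using linked[unfolded linked_def, rule_format, of J] that by blast
  have switch: "\<exists>p q. can_switch G p u v q" if "u \<in> I" "v \<in> I" "incomparable ?N u v" for u v
    using that unfolding split_can_switch_iff[OF G KI] incomparable_def by blast
  have I_switch: "\<exists>p v q. can_switch G p u v q" if u: "u \<in> I" for u
  proof -
    have "{u} \<noteq> I" using I by auto
    then obtain v where "v \<in> I" "incomparable ?N u v" using cross[of "{u}"] u by auto
    then show ?thesis using switch[OF u] by blast
  qed
  have K_switch: "\<exists>u v q. u \<in> I \<and> can_switch G k u v q" if "k \<in> K" for k
  proof -
    let ?J = "{u \<in> I. k \<in> ?N u}"
    have "?J \<noteq> {}" "?J \<subset> I" using that sep by (auto simp: separated_def)
    from cross[OF this] obtain u v where "u \<in> ?J" "v \<in> I - ?J" "incomparable ?N u v" by blast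
    then show ?thesis unfolding split_can_switch_iff[OF G KI] incomparable_def by blast
  qed
  have "active_vertex G v" if v: "v \<in> vertices G" for v
  proof -
    consider "v \<in> I" | "v \<in> K" using disj v by auto
    then show ?thesis
    proof cases
      case 1
      from I_switch[OF this] show ?thesis unfolding active_vertex_def by blast
    next
      case 2
      from K_switch[OF this] show ?thesis unfolding active_vertex_def by blast
    qed
  qed
  then have "active_graph G" by (simp add: active_graph_def)
  moreover have "\<not> decomposable G"
  proof
    assume "decomposable G"
    then obtain A B W where P: "tyshkevich_parts G A B W" using decomposable_iff[OF G] by blast
    note inside = switch_within_part[OF P]
    have parts: "vertices G = A \<union> B \<union> W" "(A \<union> B) \<inter> W = {}" "A \<union> B \<noteq> {}" "W \<noteq> {}"
      using P by (auto simp: tyshkevich_parts_def)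
    have whole: "vertices G \<subseteq> X" if "I \<subseteq> X" "(X = W \<and> Y = A \<union> B) \<or> (X = A \<union> B \<and> Y = W)" for X Y
    proof -
      have "k \<in> X" if k: "k \<in> K" for k
      proof -
        obtain u v q where "u \<in> I" "can_switch G k u v q" using K_switch[OF k] by blast
        then have "u \<in> X" "{k, u, v, q} \<subseteq> X \<or> {k, u, v, q} \<subseteq> Y"
          using inside[of k u v q] \<open>I \<subseteq> X\<close>
            \<open>(X = W \<and> Y = A \<union> B) \<or> (X = A \<union> B \<and> Y = W)\<close> by auto
        moreover have "X \<inter> Y = {}"
          using parts(2) \<open>(X = W \<and> Y = A \<union> B) \<or> (X = A \<union> B \<and> Y = W)\<close> by auto
        ultimately show ?thesis by blast
      qed
      then show ?thesis using \<open>I \<subseteq> X\<close> disj by blast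
    qed
    have "I \<subseteq> W \<or> I \<subseteq> A \<union> B"
    proof (rule ccontr)
      assume *: "\<not> ?thesis"
      then have "I \<inter> W \<noteq> {}" "I \<inter> W \<subset> I" using parts disj by auto
      from cross[OF this] obtain u v
        where uv: "u \<in> I \<inter> W" "v \<in> I - (I \<inter> W)" "incomparable ?N u v" by blast
      then obtain p q where "can_switch G p u v q" using switch[of u v] by blast
      then show False using inside[of p u v q] uv parts(2) by blast
    qed
    then have "vertices G \<subseteq> W \<or> vertices G \<subseteq> A \<union> B" using whole by blast
    then show False using parts by blast
  qed
  ultimately show ?thesis by (simp add: prime_graph_def)
qed

section \<open>Complements\<close>

lemma vertices_complement [simp]: "vertices (graph_complement G) = vertices G"
  by (simp add: graph_complement_def)

lemma complement_edge_iff: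
  "{u, v} \<in> edges (graph_complement G) \<longleftrightarrow>
    u \<in> vertices G \<and> v \<in> vertices G \<and> u \<noteq> v \<and> {u, v} \<notin> edges G"
proof -
  have "{u, v} \<in> edges (graph_complement G) \<longleftrightarrow>
      (\<exists>u' v'. {u, v} = {u', v'} \<and> u' \<in> vertices G \<and> v' \<in> vertices G \<and> u' \<noteq> v' \<and> {u', v'} \<notin> edges G)"
    by (simp add: graph_complement_def)
  also have "\<dots> \<longleftrightarrow> u \<in> vertices G \<and> v \<in> vertices G \<and> u \<noteq> v \<and> {u, v} \<notin> edges G"
    by (auto simp: doubleton_eq_iff insert_commute)
  finally show ?thesis .
qed

lemma simple_complement: "simple_graph G \<Longrightarrow> simple_graph (graph_complement G)"
  by (auto simp: simple_graph_def graph_complement_def)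

lemma complement_complement:
  assumes "simple_graph G"
  shows "graph_complement (graph_complement G) = G"
proof (rule sgraph.equality)
  have "e \<in> edges (graph_complement (graph_complement G)) \<longleftrightarrow> e \<in> edges G" for e
  proof
    assume "e \<in> edges (graph_complement (graph_complement G))"
    then obtain u v where uv: "e = {u, v}" "{u, v} \<in> edges (graph_complement (graph_complement G))"
      using simple_edgeE[OF simple_complement[OF simple_complement[OF assms]]] by metis
    then show "e \<in> edges G" unfolding complement_edge_iff vertices_complement by blast
  next
    assume "e \<in> edges G"
    then obtain u v where uv: "e = {u, v}" "u \<in> vertices G" "v \<in> vertices G" "u \<noteq> v"
      using simple_edgeE[OF assms] by metis
    then show "e \<in> edges (graph_complement (graph_complement G))"
      using \<open>e \<in> edges G\<close> by (simp add: complement_edge_iff)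
  qed
  then show "edges (graph_complement (graph_complement G)) = edges G" by blast
qed simp_all

lemma split_bipartition_complement:
  assumes "simple_graph G" "split_bipartition G K I"
  shows "split_bipartition (graph_complement G) I K"
  using assms(2) no_loop[OF assms(1)]
  by (auto simp: split_bipartition_def is_clique_def is_independent_def complement_edge_iff)

lemma nbhd_complement:
  assumes G: "simple_graph G" "split_bipartition G K I" and k: "k \<in> K"
  shows "nbhd (graph_complement G) k = {i \<in> I. k \<notin> nbhd G i}"
  using assms
  by (auto simp: nbhd_def complement_edge_iff split_bipartition_def is_clique_def insert_commute)

text \<open>Edges and non-edges of the alternating 4-cycle trade places.\<close>

lemma can_switch_complement:
  "can_switch (graph_complement G) a b x y \<longleftrightarrow> can_switch G a x b y"
  by (auto simp: can_switch_def complement_edge_iff)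

lemma two_switches_complement: "two_switches (graph_complement G) = prod.swap ` two_switches G"
proof (intro equalityI subsetI)
  fix t assume "t \<in> two_switches (graph_complement G)"
  then obtain a b x y where t: "t = ({{a, b}, {x, y}}, {{a, x}, {b, y}})"
    and "can_switch G a x b y" unfolding two_switches_def can_switch_complement by blast
  then have "({{a, x}, {b, y}}, {{a, b}, {x, y}}) \<in> two_switches G"
    unfolding two_switches_def by blast
  then show "t \<in> prod.swap ` two_switches G" unfolding t by (rule rev_image_eqI) simp
next
  fix t assume "t \<in> prod.swap ` two_switches G"
  then obtain z where t: "t = prod.swap z" and "z \<in> two_switches G" by (rule imageE)
  then obtain a b x y where "can_switch G a b x y" and "z = ({{a, b}, {x, y}}, {{a, x}, {b, y}})"
    unfolding two_switches_def by blast
  then have "t = ({{a, x}, {b, y}}, {{a, b}, {x, y}})" "can_switch (graph_complement G) a x b y"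
    by (simp_all add: t can_switch_complement)
  then show "t \<in> two_switches (graph_complement G)" unfolding two_switches_def by blast
qed

lemma switch_degree_complement: "switch_degree (graph_complement G) = switch_degree G"
  unfolding switch_degree_def two_switches_complement by (rule card_image) simp

lemma active_complement: "active_graph (graph_complement G) = active_graph G"
proof -
  have "active_vertex (graph_complement G) v = active_vertex G v" for v
    unfolding active_vertex_def can_switch_complement by blast
  then show ?thesis by (simp add: active_graph_def)
qed

lemma tyshkevich_parts_complement:
  assumes "simple_graph G" and P: "tyshkevich_parts G K I W"
  shows "tyshkevich_parts (graph_complement G) I K W"
proof -
  have V: "vertices G = K \<union> I \<union> W" "K \<inter> I = {}" "(K \<union> I) \<inter> W = {}" "K \<union> I \<noteq> {}" "W \<noteq> {}"
    and cl: "is_clique G K" and ind: "is_independent G I"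
    and join: "\<forall>w \<in> W. (\<forall>k \<in> K. {k, w} \<in> edges G) \<and> (\<forall>i \<in> I. {i, w} \<notin> edges G)"
    using P by (simp_all add: tyshkevich_parts_def)
  have "is_clique (graph_complement G) I" using ind
    by (auto simp: is_independent_def is_clique_def complement_edge_iff)
  moreover have "is_independent (graph_complement G) K" using cl no_loop[OF assms(1)]
    by (auto simp: is_independent_def is_clique_def complement_edge_iff)
  moreover have "{i, w} \<in> edges (graph_complement G)" if "i \<in> I" "w \<in> W" for i w
    using join V that by (auto simp: complement_edge_iff)
  moreover have "{k, w} \<notin> edges (graph_complement G)" if "k \<in> K" "w \<in> W" for k w
    using join that by (auto simp: complement_edge_iff)
  ultimately show ?thesis
    unfolding tyshkevich_parts_def using V by (simp add: Un_commute Int_commute)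
qed

lemma prime_complement:
  assumes "simple_graph G"
  shows "prime_graph (graph_complement G) \<longleftrightarrow> prime_graph G"
proof -
  have "decomposable (graph_complement G) \<longleftrightarrow> decomposable G"
    using tyshkevich_parts_complement[OF assms]
      tyshkevich_parts_complement[OF simple_complement[OF assms]]
    unfolding decomposable_iff[OF assms] decomposable_iff[OF simple_complement[OF assms]]
      complement_complement[OF assms] by metis
  then show ?thesis by (simp add: prime_graph_def active_complement)
qed

lemma split_complement: "simple_graph G \<Longrightarrow> split_graph G \<Longrightarrow> split_graph (graph_complement G)"
  unfolding split_graph_def using split_bipartition_complement by metis

section \<open>Isomorphisms\<close>

definition isomorphism :: "('a \<Rightarrow> 'b) \<Rightarrow> 'a sgraph \<Rightarrow> 'b sgraph \<Rightarrow> bool" where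
  "isomorphism f G H \<longleftrightarrow> bij_betw f (vertices G) (vertices H) \<and>
     (\<forall>u \<in> vertices G. \<forall>v \<in> vertices G. {u, v} \<in> edges G \<longleftrightarrow> {f u, f v} \<in> edges H)"

lemma graph_iso_iff: "graph_iso G H \<longleftrightarrow> (\<exists>f. isomorphism f G H)"
  by (simp add: graph_iso_def isomorphism_def)

lemma isomorphism_inv:
  assumes "isomorphism f G H"
  shows "isomorphism (inv_into (vertices G) f) H G"
proof -
  have b: "bij_betw f (vertices G) (vertices H)"
    and e: "\<And>u v. u \<in> vertices G \<Longrightarrow> v \<in> vertices G \<Longrightarrow>
      {u, v} \<in> edges G \<longleftrightarrow> {f u, f v} \<in> edges H"
    using assms by (auto simp: isomorphism_def)
  let ?g = "inv_into (vertices G) f"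
  have g: "?g w \<in> vertices G" "f (?g w) = w" if "w \<in> vertices H" for w
    using b that by (auto simp: bij_betw_def inv_into_into f_inv_into_f)
  show ?thesis
    unfolding isomorphism_def using bij_betw_inv_into[OF b] e g by simp
qed

lemma graph_iso_sym: "graph_iso G H \<Longrightarrow> graph_iso H G"
  unfolding graph_iso_iff using isomorphism_inv by blast

lemma graph_iso_complement:
  assumes "graph_iso G H"
  shows "graph_iso (graph_complement G) (graph_complement H)"
proof -
  obtain f where f: "isomorphism f G H" using assms by (auto simp: graph_iso_iff)
  have "isomorphism f (graph_complement G) (graph_complement H)"
    unfolding isomorphism_def
  proof (intro conjI ballI)
    show "bij_betw f (vertices (graph_complement G)) (vertices (graph_complement H))"
      using f by (simp add: isomorphism_def)
    fix u v assume "u \<in> vertices (graph_complement G)" "v \<in> vertices (graph_complement G)"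
    then have uv: "u \<in> vertices G" "v \<in> vertices G" by simp_all
    moreover have "f u = f v \<longleftrightarrow> u = v" "f u \<in> vertices H" "f v \<in> vertices H"
      using f uv by (auto simp: isomorphism_def bij_betw_def inj_on_def)
    ultimately show "({u, v} \<in> edges (graph_complement G)) = ({f u, f v} \<in> edges (graph_complement H))"
      using f by (simp add: complement_edge_iff isomorphism_def)
  qed
  then show ?thesis by (auto simp: graph_iso_iff)
qed

context
  fixes f :: "'a \<Rightarrow> 'b" and G :: "'a sgraph" and H :: "'b sgraph"
  assumes f: "isomorphism f G H"
begin

lemma isomorphism_inj: "inj_on f (vertices G)"
  and isomorphism_image: "f ` vertices G = vertices H"
  using f by (auto simp: isomorphism_def bij_betw_def)

lemma isomorphism_edge:
  "u \<in> vertices G \<Longrightarrow> v \<in> vertices G \<Longrightarrow> {f u, f v} \<in> edges H \<longleftrightarrow> {u, v} \<in> edges G"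
  using f by (auto simp: isomorphism_def)

lemma isomorphism_can_switch:
  assumes "{a, b, x, y} \<subseteq> vertices G"
  shows "can_switch H (f a) (f b) (f x) (f y) \<longleftrightarrow> can_switch G a b x y"
proof -
  have "f u = f v \<longleftrightarrow> u = v" if "u \<in> {a, b, x, y}" "v \<in> {a, b, x, y}" for u v
    using isomorphism_inj that assms by (auto dest: inj_onD)
  moreover have "{f a, f b, f x, f y} \<subseteq> vertices H" using assms isomorphism_image by blast
  ultimately show ?thesis
    using assms by (simp add: can_switch_def isomorphism_edge)
qed

lemma can_switch_preimage:
  assumes "can_switch H a' b' x' y'"
  obtains a b x y where "can_switch G a b x y" "a' = f a" "b' = f b" "x' = f x" "y' = f y"
proof -
  have "{a', b', x', y'} \<subseteq> f ` vertices G"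
    using assms isomorphism_image by (simp add: can_switch_def)
  then obtain a b x y where *: "{a, b, x, y} \<subseteq> vertices G" "a' = f a" "b' = f b" "x' = f x" "y' = f y"
    by auto
  then show ?thesis using that assms isomorphism_can_switch by simp
qed

lemma isomorphism_active: "active_graph G \<Longrightarrow> active_graph H"
proof -
  assume act: "active_graph G"
  have "active_vertex H (f v)" if v: "v \<in> vertices G" for v
  proof -
    obtain a b x y where s: "can_switch G a b x y" "v \<in> {a, b, x, y}"
      using act v unfolding active_graph_def active_vertex_def by blast
    have "{a, b, x, y} \<subseteq> vertices G" using s(1) unfolding can_switch_def by (elim conjE)
    then have "can_switch H (f a) (f b) (f x) (f y)" using s(1) isomorphism_can_switch by blast
    moreover have "f v \<in> {f a, f b, f x, f y}" using s(2) by auto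
    ultimately show ?thesis unfolding active_vertex_def by blast
  qed
  then show ?thesis unfolding active_graph_def isomorphism_image[symmetric] by blast
qed

lemma isomorphism_two_switches:
  "two_switches H = map_prod (image (image f)) (image (image f)) ` two_switches G" (is "_ = ?F ` _")
proof (intro equalityI subsetI)
  fix t assume "t \<in> two_switches H"
  then obtain a' b' x' y' where t: "t = ({{a', b'}, {x', y'}}, {{a', x'}, {b', y'}})"
    and "can_switch H a' b' x' y'" unfolding two_switches_def by blast
  from can_switch_preimage[OF this(2)] obtain a b x y
    where s: "can_switch G a b x y" "a' = f a" "b' = f b" "x' = f x" "y' = f y" by metis
  then have "({{a, b}, {x, y}}, {{a, x}, {b, y}}) \<in> two_switches G"
    unfolding two_switches_def by blast
  then show "t \<in> ?F ` two_switches G" by (rule rev_image_eqI) (use s t in simp)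
next
  fix t assume "t \<in> ?F ` two_switches G"
  then obtain z where "t = ?F z" "z \<in> two_switches G" by (rule imageE)
  then obtain a b x y where s: "can_switch G a b x y"
    and t: "t = ?F ({{a, b}, {x, y}}, {{a, x}, {b, y}})" unfolding two_switches_def by blast
  have "{a, b, x, y} \<subseteq> vertices G" using s unfolding can_switch_def by (elim conjE)
  then have "can_switch H (f a) (f b) (f x) (f y)" using s isomorphism_can_switch by blast
  moreover have "t = ({{f a, f b}, {f x, f y}}, {{f a, f x}, {f b, f y}})" by (simp add: t)
  ultimately show "t \<in> two_switches H" unfolding two_switches_def by blast
qed

lemma isomorphism_switch_degree: "switch_degree H = switch_degree G"
proof -
  have "inj_on (image f) (Pow (vertices G))"
    using isomorphism_inj by (rule inj_on_image_Pow)
  then have "inj_on (image (image f)) (Pow (Pow (vertices G)))" by (rule inj_on_image_Pow)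
  then have "inj_on (map_prod (image (image f)) (image (image f)))
      (Pow (Pow (vertices G)) \<times> Pow (Pow (vertices G)))"
    by (intro map_prod_inj_on)
  moreover have "two_switches G \<subseteq> Pow (Pow (vertices G)) \<times> Pow (Pow (vertices G))"
    by (auto simp: two_switches_def can_switch_def)
  ultimately show ?thesis
    unfolding switch_degree_def isomorphism_two_switches
    by (intro card_image) (rule inj_on_subset)
qed

lemma isomorphism_clique:
  assumes "is_clique G K" shows "is_clique H (f ` K)"
proof -
  have K: "K \<subseteq> vertices G" using assms by (simp add: is_clique_def)
  moreover have "{f u, f v} \<in> edges H" if "u \<in> K" "v \<in> K" "f u \<noteq> f v" for u v
  proof -
    have "{u, v} \<in> edges G" using assms that by (auto simp: is_clique_def)
    then show ?thesis using isomorphism_edge[of u v] K that by blast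
  qed
  ultimately show ?thesis by (auto simp: is_clique_def isomorphism_image[symmetric])
qed

lemma isomorphism_independent:
  assumes "is_independent G I" shows "is_independent H (f ` I)"
proof -
  have "I \<subseteq> vertices G" using assms by (simp add: is_independent_def)
  moreover have "{f u, f v} \<notin> edges H" if "u \<in> I" "v \<in> I" for u v
    using assms that isomorphism_edge[of u v] by (auto simp: is_independent_def)
  ultimately show ?thesis by (auto simp: is_independent_def isomorphism_image[symmetric])
qed

lemma isomorphism_disjoint:
  assumes "A \<subseteq> vertices G" "B \<subseteq> vertices G" "A \<inter> B = {}"
  shows "f ` A \<inter> f ` B = {}"
  using inj_on_image_Int[OF isomorphism_inj assms(1,2)] assms(3) by simp

lemma isomorphism_split_bipartition:
  assumes "split_bipartition G K I" shows "split_bipartition H (f ` K) (f ` I)"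
  using assms isomorphism_clique[of K] isomorphism_independent[of I] isomorphism_disjoint[of K I]
    isomorphism_image
  by (simp add: split_bipartition_def image_Un[symmetric] is_clique_def is_independent_def)

lemma isomorphism_tyshkevich_parts:
  assumes P: "tyshkevich_parts G K I W" shows "tyshkevich_parts H (f ` K) (f ` I) (f ` W)"
proof -
  have V: "vertices G = K \<union> I \<union> W" "K \<inter> I = {}" "(K \<union> I) \<inter> W = {}" "K \<union> I \<noteq> {}" "W \<noteq> {}"
    and cl: "is_clique G K" and ind: "is_independent G I"
    and join: "\<forall>w \<in> W. (\<forall>k \<in> K. {k, w} \<in> edges G) \<and> (\<forall>i \<in> I. {i, w} \<notin> edges G)"
    using P by (simp_all add: tyshkevich_parts_def)
  have "{f k, f w} \<in> edges H" if "k \<in> K" "w \<in> W" for k w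
    using that join V(1) isomorphism_edge[of k w] by simp
  moreover have "{f i, f w} \<notin> edges H" if "i \<in> I" "w \<in> W" for i w
    using that join V(1) isomorphism_edge[of i w] by simp
  moreover have "vertices H = f ` K \<union> f ` I \<union> f ` W"
    using isomorphism_image V(1) by (simp add: image_Un)
  moreover have "f ` K \<inter> f ` I = {}" "f ` (K \<union> I) \<inter> f ` W = {}"
    using isomorphism_disjoint[of K I] isomorphism_disjoint[of "K \<union> I" W] V by auto
  ultimately show ?thesis
    using V(4,5) isomorphism_clique[OF cl] isomorphism_independent[OF ind]
    by (simp add: tyshkevich_parts_def image_Un)
qed

lemma isomorphism_edges:
  assumes "simple_graph G" "simple_graph H" shows "edges H = image f ` edges G"
proof (intro equalityI subsetI)
  fix e assume e: "e \<in> edges H"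
  obtain u' v' where "e = {u', v'}" "u' \<in> vertices H" "v' \<in> vertices H"
    using simple_edgeE[OF assms(2) e] by metis
  then obtain u v where uv: "e = {f u, f v}" "u \<in> vertices G" "v \<in> vertices G"
    unfolding isomorphism_image[symmetric] by auto
  then have "{u, v} \<in> edges G" using e isomorphism_edge by simp
  then show "e \<in> image f ` edges G" using uv(1) by (intro image_eqI[of _ _ "{u, v}"]) auto
next
  fix e assume "e \<in> image f ` edges G"
  then obtain d where d: "d \<in> edges G" "e = f ` d" by blast
  obtain u v where uv: "d = {u, v}" "u \<in> vertices G" "v \<in> vertices G"
    using simple_edgeE[OF assms(1) d(1)] by metis
  then show "e \<in> edges H" using d isomorphism_edge[of u v] by simp
qed

lemma isomorphism_card_edges:
  assumes "simple_graph G" "simple_graph H" shows "card (edges H) = card (edges G)"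
proof -
  have "edges G \<subseteq> Pow (vertices G)" using assms(1) by (auto simp: simple_graph_def)
  then have "inj_on (image f) (edges G)"
    using inj_on_image_Pow[OF isomorphism_inj] inj_on_subset by blast
  then show ?thesis unfolding isomorphism_edges[OF assms] by (rule card_image)
qed

end

lemma graph_iso_card:
  assumes "simple_graph G" "simple_graph H" "graph_iso G H"
  shows "card (vertices G) = card (vertices H)" "card (edges G) = card (edges H)"
proof -
  obtain f where f: "isomorphism f G H" using assms(3) by (auto simp: graph_iso_iff)
  show "card (vertices G) = card (vertices H)"
    using f bij_betw_same_card by (auto simp: isomorphism_def)
  show "card (edges G) = card (edges H)"
    using isomorphism_card_edges[OF f assms(1,2)] by simp
qed

lemma graph_iso_prime_split:
  assumes "simple_graph G" "simple_graph H" "graph_iso G H"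
    and "prime_graph H" "split_graph H"
  shows "prime_graph G" "split_graph G" "switch_degree G = switch_degree H"
proof -
  obtain f g where f: "isomorphism f G H" and g: "isomorphism g H G"
    using assms(3) graph_iso_sym[OF assms(3)] by (auto simp: graph_iso_iff)
  have "\<not> decomposable G"
    using isomorphism_tyshkevich_parts[OF f] assms(4) decomposable_iff[OF assms(1)]
      decomposable_iff[OF assms(2)] by (auto simp: prime_graph_def)
  moreover have "active_graph G"
    using isomorphism_active[OF g] assms(4) by (simp add: prime_graph_def)
  ultimately show "prime_graph G" by (simp add: prime_graph_def)
  show "split_graph G"
    using isomorphism_split_bipartition[OF g] assms(5) by (auto simp: split_graph_def)
  show "switch_degree G = switch_degree H"
    using isomorphism_switch_degree[OF f] by simp
qed

section \<open>Split graphs given by lists of neighbourhoods\<close>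

lemma simple_edges_subset_Pow: "simple_graph G \<Longrightarrow> edges G \<subseteq> Pow (vertices G)"
  by (auto simp: simple_graph_def)

lemma split_from_nbhds_edge_iffs:
  "{Inl j, Inl k} \<in> edges (split_from_nbhds n Ns) \<longleftrightarrow> j \<in> {1..n} \<and> k \<in> {1..n} \<and> j \<noteq> k"
  "{Inr i, Inl k} \<in> edges (split_from_nbhds n Ns) \<longleftrightarrow> i < length Ns \<and> k \<in> Ns ! i"
  "{Inl k, Inr i} \<in> edges (split_from_nbhds n Ns) \<longleftrightarrow> i < length Ns \<and> k \<in> Ns ! i"
  "{Inr i, Inr i'} \<notin> edges (split_from_nbhds n Ns)"
  by (auto simp: split_from_nbhds_def doubleton_eq_iff)

lemma simple_split_from_nbhds:
  assumes "1 \<le> n" "\<And>N. N \<in> set Ns \<Longrightarrow> N \<subseteq> {1..n}"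
  shows "simple_graph (split_from_nbhds n Ns)"
proof -
  have "edges (split_from_nbhds n Ns)
      \<subseteq> {{u, v} |u v. u \<in> vertices (split_from_nbhds n Ns) \<and> v \<in> vertices (split_from_nbhds n Ns) \<and> u \<noteq> v}"
  proof
    fix e assume "e \<in> edges (split_from_nbhds n Ns)"
    then consider j k where "e = {Inl j, Inl k}" "j \<in> {1..n}" "k \<in> {1..n}" "j \<noteq> k"
      | i k where "e = {Inr i, Inl k}" "i < length Ns" "k \<in> Ns ! i"
      unfolding split_from_nbhds_def by auto
    then show "e \<in> {{u, v} |u v. u \<in> vertices (split_from_nbhds n Ns) \<and> v \<in> vertices (split_from_nbhds n Ns) \<and> u \<noteq> v}"
    proof cases
      case 1
      then have "Inl j \<in> vertices (split_from_nbhds n Ns)" "Inl k \<in> vertices (split_from_nbhds n Ns)"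
        "Inl j \<noteq> (Inl k :: nat + nat)" by (simp_all add: split_from_nbhds_def)
      then show ?thesis using 1(1) by blast
    next
      case 2
      then have "k \<in> {1..n}" using assms(2) nth_mem by blast
      then have "Inr i \<in> vertices (split_from_nbhds n Ns)" "Inl k \<in> vertices (split_from_nbhds n Ns)"
        "Inr i \<noteq> (Inl k :: nat + nat)" using 2 by (simp_all add: split_from_nbhds_def)
      then show ?thesis using 2(1) by blast
    qed
  qed
  then show ?thesis using assms(1) by (auto simp: simple_graph_def split_from_nbhds_def)
qed

lemma split_bipartition_from_nbhds:
  "split_bipartition (split_from_nbhds n Ns) (Inl ` {1..n}) (Inr ` {..<length Ns})"
proof -
  have "vertices (split_from_nbhds n Ns) = Inl ` {1..n} \<union> Inr ` {..<length Ns}"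
    by (simp add: split_from_nbhds_def)
  then show ?thesis
    by (auto simp: split_bipartition_def is_clique_def is_independent_def split_from_nbhds_edge_iffs)
qed

lemma nbhd_from_nbhds:
  assumes "i < length Ns"
  shows "nbhd (split_from_nbhds n Ns) (Inr i) = Inl ` (Ns ! i)"
proof -
  have "w \<in> nbhd (split_from_nbhds n Ns) (Inr i) \<longleftrightarrow> w \<in> Inl ` (Ns ! i)" for w
    using assms by (cases w) (auto simp: nbhd_def split_from_nbhds_edge_iffs)
  then show ?thesis by blast
qed

lemma switch_degree_from_nbhds:
  assumes "1 \<le> n" "\<And>N. N \<in> set Ns \<Longrightarrow> N \<subseteq> {1..n}"
  shows "2 * switch_degree (split_from_nbhds n Ns)
    = (\<Sum>i<length Ns. \<Sum>j<length Ns. crossing (nth Ns) i j)"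
proof -
  let ?H = "split_from_nbhds n Ns"
  have "crossing (nbhd ?H) (Inr i) (Inr j) = crossing (nth Ns) i j"
    if "i < length Ns" "j < length Ns" for i j
    using that
    by (simp add: crossing_def nbhd_from_nbhds image_set_diff[symmetric] card_image)
  then have "(\<Sum>i<length Ns. \<Sum>j<length Ns. crossing (nbhd ?H) (Inr i) (Inr j))
      = (\<Sum>i<length Ns. \<Sum>j<length Ns. crossing (nth Ns) i j)" by simp
  then show ?thesis
    using split_switch_degree[OF simple_split_from_nbhds split_bipartition_from_nbhds, of n Ns] assms
    by (simp add: sum.reindex)
qed

text \<open>In the graphs to which this is applied, one row is incomparable to all others, so linkedness can
  be checked at that row \<open>c\<close> instead of for every cut.\<close>

lemma prime_split_from_nbhds:
  assumes "1 \<le> n" "\<And>N. N \<in> set Ns \<Longrightarrow> N \<subseteq> {1..n}"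
    and "2 \<le> length Ns" "separated (nth Ns) {..<length Ns} = {1..n}"
    and c: "c < length Ns" "\<And>i. i < length Ns \<Longrightarrow> i \<noteq> c \<Longrightarrow> incomparable (nth Ns) c i"
  shows "prime_graph (split_from_nbhds n Ns)"
proof (rule linked_imp_prime_split[OF simple_split_from_nbhds[OF assms(1,2)] split_bipartition_from_nbhds])
  let ?I = "Inr ` {..<length Ns} :: (nat + nat) set"
  let ?N = "nbhd (split_from_nbhds n Ns)"
  show "2 \<le> card ?I" using assms(3) by (simp add: card_image)
  have "(\<Union>u\<in>?I. ?N u) = Inl ` (\<Union>i<length Ns. Ns ! i)"
    by (auto simp: nbhd_from_nbhds)
  moreover have "(\<Inter>u\<in>?I. ?N u) = Inl ` (\<Inter>i<length Ns. Ns ! i)"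
  proof -
    have "(\<Inter>u\<in>?I. ?N u) = (\<Inter>i<length Ns. Inl ` (Ns ! i))" by (simp add: nbhd_from_nbhds)
    also have "\<dots> = Inl ` (\<Inter>i<length Ns. Ns ! i)"
      using c(1) by (subst image_INT[of Inl UNIV]) auto
    finally show ?thesis .
  qed
  ultimately show "separated ?N ?I = Inl ` {1..n}"
    using assms(4) by (simp add: separated_def image_set_diff[symmetric])
  have "incomparable ?N (Inr c) u" if u: "u \<in> ?I" "u \<noteq> Inr c" for u
  proof -
    obtain i where "u = Inr i" "i < length Ns" using u by auto
    then show ?thesis using c u by (auto simp: incomparable_def nbhd_from_nbhds inj_image_subset_iff)
  qed
  then show "linked ?I ?N" using c(1) by (intro linked_star[of "Inr c"]) auto
qed

lemma card_all_pairs: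
  assumes "finite V"
  shows "card {{u, v} | u v. u \<in> V \<and> v \<in> V \<and> u \<noteq> v} = card V choose 2"
proof -
  have "{{u, v} | u v. u \<in> V \<and> v \<in> V \<and> u \<noteq> v} = {e. e \<subseteq> V \<and> card e = 2}"
    by (auto simp: card_2_iff)
  then show ?thesis using n_subsets[OF assms] by simp
qed

lemma card_edges_complement:
  assumes "simple_graph G"
  shows "card (edges (graph_complement G)) = (card (vertices G) choose 2) - card (edges G)"
proof -
  let ?P = "{{u, v} | u v. u \<in> vertices G \<and> v \<in> vertices G \<and> u \<noteq> v}"
  have "edges (graph_complement G) = ?P - edges G" by (auto simp: graph_complement_def)
  moreover have "finite (vertices G)" "edges G \<subseteq> ?P" using assms by (simp_all add: simple_graph_def)
  moreover from this have "finite (edges G)"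
    by (meson finite_Pow_iff finite_subset order_trans simple_edges_subset_Pow[OF assms])
  ultimately show ?thesis by (simp add: card_Diff_subset card_all_pairs)
qed

lemma card_edges_from_nbhds:
  assumes "\<And>N. N \<in> set Ns \<Longrightarrow> N \<subseteq> {1..n}"
  shows "card (edges (split_from_nbhds n Ns)) = (n choose 2) + (\<Sum>i<length Ns. card (Ns ! i))"
proof -
  let ?A = "{{u, v} | u v. u \<in> Inl ` {1..n} \<and> v \<in> Inl ` {1..n} \<and> u \<noteq> v} :: (nat + nat) set set"
  let ?S = "SIGMA i:{..<length Ns}. Ns ! i"
  let ?f = "\<lambda>(i, k). {Inr i, Inl k} :: (nat + nat) set"
  have fin: "finite (Ns ! i)" if "i < length Ns" for i
    using assms[OF nth_mem[OF that]] finite_subset by blast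
  have "{{Inl j, Inl k} |j k. j \<in> {1..n} \<and> k \<in> {1..n} \<and> j \<noteq> k} = ?A" by blast
  moreover have "{{Inr i, Inl k} |i k. i < length Ns \<and> k \<in> Ns ! i} = ?f ` ?S" by auto
  ultimately have "edges (split_from_nbhds n Ns) = ?A \<union> ?f ` ?S"
    by (simp add: split_from_nbhds_def)
  moreover have "?A \<inter> ?f ` ?S = {}" by (auto simp: doubleton_eq_iff)
  moreover have "finite ?A" by (rule finite_subset[of _ "Pow (Inl ` {1..n})"]) auto
  moreover have "finite (?f ` ?S)" using fin by auto
  ultimately have "card (edges (split_from_nbhds n Ns)) = card ?A + card (?f ` ?S)"
    by (simp only: card_Un_disjoint)
  moreover have "card ?A = n choose 2"
    by (subst card_all_pairs) (simp_all add: card_image)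
  moreover have "inj_on ?f ?S" by (auto simp: inj_on_def doubleton_eq_iff)
  moreover have "card ?S = (\<Sum>i<length Ns. card (Ns ! i))" using fin by simp
  ultimately show ?thesis by (simp add: card_image)
qed

lemma card_vertices_from_nbhds: "card (vertices (split_from_nbhds n Ns)) = n + length Ns"
  unfolding split_from_nbhds_def
  by (simp, subst card_Un_disjoint) (auto simp: card_image)

text \<open>An enumeration of \<open>K\<close> and \<open>I\<close> is all that is needed to recognise \<open>G\<close>. The vertex \<open>Inl j\<close> goes to the
  entry with index \<open>j - 1\<close>, as list indices start at 0 but the clique at 1.\<close>

lemma iso_split_from_nbhds:
  assumes G: "simple_graph G" "split_bipartition G K I"
    and us: "distinct us" "set us = I" and ks: "distinct ks" "set ks = K"
    and len: "length us = length Ns"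
    and Ns: "\<And>N. N \<in> set Ns \<Longrightarrow> N \<subseteq> {1..length ks}"
    and nb: "\<And>i. i < length us \<Longrightarrow> nbhd G (us ! i) = (\<lambda>j. ks ! (j - 1)) ` (Ns ! i)"
  shows "graph_iso G (split_from_nbhds (length ks) Ns)"
proof (rule graph_iso_sym)
  let ?H = "split_from_nbhds (length ks) Ns"
  define g where "g = case_sum (\<lambda>j. ks ! (j - 1)) (\<lambda>i. us ! i)"
  have disj: "K \<inter> I = {}" "K \<union> I = vertices G" using G(2) by (auto simp: split_bipartition_def)
  have VH: "vertices ?H = Inl ` {1..length ks} \<union> Inr ` {..<length Ns}"
    by (simp add: split_from_nbhds_def)
  have gK: "g (Inl j) = ks ! (j - 1)" "g (Inl j) \<in> K" if "j \<in> {1..length ks}" for j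
    using that ks by (auto simp: g_def)
  have gI: "g (Inr i) = us ! i" "g (Inr i) \<in> I" if "i < length Ns" for i
    using that us len by (auto simp: g_def)
  have injK: "ks ! (j - 1) = ks ! (k - 1) \<longleftrightarrow> j = k"
    if "j \<in> {1..length ks}" "k \<in> {1..length ks}" for j k
    using that ks(1) by (auto simp: nth_eq_iff_index_eq)
  have "bij_betw g (vertices ?H) (vertices G)"
    unfolding bij_betw_def
  proof
    have "g u \<noteq> g v" if "u \<in> Inl ` {1..length ks}" "v \<in> Inr ` {..<length Ns}" for u v
    proof -
      have "g u \<in> K" "g v \<in> I" using that gK(2) gI(2) by auto
      then show ?thesis using disj(1) by auto
    qed
    moreover have "inj_on g (Inl ` {1..length ks})"
      using gK(1) injK by (simp add: inj_on_def)
    moreover have "inj_on g (Inr ` {..<length Ns})"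
      using gI(1) us(1) len by (auto simp: inj_on_def nth_eq_iff_index_eq)
    ultimately show "inj_on g (vertices ?H)"
      unfolding VH inj_on_def by (metis UnE)
    have "g ` Inl ` {1..length ks} = K"
    proof -
      have "g ` Inl ` {1..length ks} = (\<lambda>j. ks ! (j - 1)) ` {1..length ks}"
        unfolding image_image by (intro image_cong) (use gK in auto)
      also have "\<dots> = (!) ks ` {..<length ks}"
        by (force simp: image_iff intro: bexI[of _ "Suc _"])
      finally show ?thesis using ks(2) by (metis atLeast0LessThan nth_image order_refl take_all)
    qed
    moreover have "g ` Inr ` {..<length Ns} = I"
    proof -
      have "g ` Inr ` {..<length Ns} = (!) us ` {..<length us}"
        unfolding image_image len[symmetric] by (intro image_cong) (use gI len in auto)
      then show ?thesis using us(2) by (metis atLeast0LessThan nth_image order_refl take_all)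
    qed
    ultimately show "g ` vertices ?H = vertices G" using disj by (simp add: VH image_Un)
  qed
  moreover have "{u, v} \<in> edges ?H \<longleftrightarrow> {g u, g v} \<in> edges G"
    if uv: "u \<in> vertices ?H" "v \<in> vertices ?H" for u v
  proof -
    have KI: "{g (Inr i), g (Inl k)} \<in> edges G \<longleftrightarrow> k \<in> Ns ! i"
      if ik: "i < length Ns" "k \<in> {1..length ks}" for i k
    proof -
      have "Ns ! i \<subseteq> {1..length ks}" using Ns nth_mem[OF ik(1)] by blast
      then have "k \<in> Ns ! i \<longleftrightarrow> ks ! (k - 1) \<in> (\<lambda>j. ks ! (j - 1)) ` (Ns ! i)"
        using injK[OF ik(2)] unfolding image_iff by blast
      also have "\<dots> \<longleftrightarrow> {us ! i, ks ! (k - 1)} \<in> edges G"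
        unfolding nb[of i, symmetric, unfolded len, OF ik(1)] by (simp add: nbhd_def)
      finally show ?thesis using gI(1)[OF ik(1)] gK(1)[OF ik(2)] by simp
    qed
    have KK: "{g (Inl j), g (Inl k)} \<in> edges G \<longleftrightarrow> j \<noteq> k"
      if jk: "j \<in> {1..length ks}" "k \<in> {1..length ks}" for j k
      using gK[OF jk(1)] gK[OF jk(2)] injK[OF jk] G(2) no_loop[OF G(1)]
      by (auto simp: split_bipartition_def is_clique_def)
    have II: "{g (Inr i), g (Inr i')} \<notin> edges G" if "i < length Ns" "i' < length Ns" for i i'
      using gI(2)[OF that(1)] gI(2)[OF that(2)] G(2)
      by (auto simp: split_bipartition_def is_independent_def)
    show ?thesis
      using uv KI KK II unfolding VH
      by (auto simp: split_from_nbhds_edge_iffs insert_commute[of "g (Inl _)" "g (Inr _)"])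
  qed
  ultimately show "graph_iso ?H G" unfolding graph_iso_def by blast
qed

section \<open>The twelve graphs are prime of degree four\<close>

lemma separated_pair: "separated (nth [A, B]) {..<2} = (A \<union> B) - (A \<inter> B)"
  by (simp add: separated_def lessThan_Suc numeral_2_eq_2 Un_commute Int_commute)

lemma separated_triple: "separated (nth [A, B, C]) {..<3} = (A \<union> B \<union> C) - (A \<inter> B \<inter> C)"
  by (auto simp add: separated_def lessThan_Suc numeral_3_eq_3)

text \<open>With two disjoint rows covering the clique, primality amounts to both rows being nonempty, and the
  degree is one product.\<close>

lemma two_list_degree_four:
  assumes n: "1 \<le> n" and sub: "A \<union> B = {1..n}" "A \<inter> B = {}"
    and inc: "\<not> A \<subseteq> B" "\<not> B \<subseteq> A"
    and four: "card (A - B) * card (B - A) = 4"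
  shows "simple_graph (split_from_nbhds n [A, B]) \<and> prime_graph (split_from_nbhds n [A, B]) \<and>
    split_graph (split_from_nbhds n [A, B]) \<and> switch_degree (split_from_nbhds n [A, B]) = 4"
proof -
  have Ns: "\<And>N. N \<in> set [A, B] \<Longrightarrow> N \<subseteq> {1..n}" using sub by auto
  have "prime_graph (split_from_nbhds n [A, B])"
  proof (rule prime_split_from_nbhds[OF n Ns, where c = 1])
    show "separated (nth [A, B]) {..<length [A, B]} = {1..n}"
      using separated_pair[of A B] sub by (simp add: numeral_2_eq_2)
    show "incomparable (nth [A, B]) 1 i" if "i < length [A, B]" "i \<noteq> 1" for i
      using that inc by (auto simp: incomparable_def less_Suc_eq)
  qed auto
  moreover have "2 * switch_degree (split_from_nbhds n [A, B]) = 2 * 4"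
    using four by (subst switch_degree_from_nbhds[OF n Ns])
      (auto simp: crossing_def lessThan_Suc mult.commute)
  moreover have "simple_graph (split_from_nbhds n [A, B])"
    by (rule simple_split_from_nbhds[OF n Ns])
  moreover have "split_graph (split_from_nbhds n [A, B])"
    unfolding split_graph_def using split_bipartition_from_nbhds by blast
  ultimately show ?thesis by simp
qed

text \<open>The middle row \<open>B\<close> is incomparable to the nested rows \<open>A\<close> and \<open>C\<close>, so only its two products
  contribute to the degree.\<close>

lemma three_list_degree_four:
  assumes n: "1 \<le> n" and sub: "A \<union> B \<union> C = {1..n}" "A \<inter> B \<inter> C = {}"
    and inc: "\<not> A \<subseteq> B" "\<not> B \<subseteq> A" "\<not> B \<subseteq> C" "\<not> C \<subseteq> B" and AC: "A \<subseteq> C"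
    and four: "card (A - B) * card (B - A) + card (C - B) * card (B - C) = 4"
  shows "simple_graph (split_from_nbhds n [A, B, C]) \<and> prime_graph (split_from_nbhds n [A, B, C]) \<and>
    split_graph (split_from_nbhds n [A, B, C]) \<and> switch_degree (split_from_nbhds n [A, B, C]) = 4"
proof -
  have Ns: "\<And>N. N \<in> set [A, B, C] \<Longrightarrow> N \<subseteq> {1..n}" using sub by auto
  have "prime_graph (split_from_nbhds n [A, B, C])"
  proof (rule prime_split_from_nbhds[OF n Ns, where c = 1])
    show "separated (nth [A, B, C]) {..<length [A, B, C]} = {1..n}"
      using separated_triple[of A B C] sub by (simp add: numeral_3_eq_3)
    show "incomparable (nth [A, B, C]) 1 i" if "i < length [A, B, C]" "i \<noteq> 1" for i
      using that inc by (auto simp: incomparable_def less_Suc_eq)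
  qed auto
  moreover have "2 * switch_degree (split_from_nbhds n [A, B, C]) = 2 * 4"
  proof -
    have "card (A - C) = 0" using AC by (simp add: Diff_eq_empty_iff[THEN iffD2])
    then have "(\<Sum>i<length [A, B, C]. \<Sum>j<length [A, B, C]. crossing (nth [A, B, C]) i j)
        = 2 * (card (A - B) * card (B - A) + card (C - B) * card (B - C))"
      by (simp add: crossing_def lessThan_Suc algebra_simps del: card_eq_0_iff)
    then show ?thesis using four by (subst switch_degree_from_nbhds[OF n Ns]) (simp_all only:)
  qed
  moreover have "simple_graph (split_from_nbhds n [A, B, C])"
    by (rule simple_split_from_nbhds[OF n Ns])
  moreover have "split_graph (split_from_nbhds n [A, B, C])"
    unfolding split_graph_def using split_bipartition_from_nbhds by blast
  ultimately show ?thesis by simp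
qed

text \<open>One graph from each pair of complementary graphs in the list.\<close>

abbreviation uncomplemented :: "(nat + nat) sgraph set" where
  "uncomplemented \<equiv> {D41, D22, R311, R331, R211, R321}"

lemma uncomplemented_degree_four:
  assumes "H \<in> uncomplemented"
  shows "simple_graph H \<and> prime_graph H \<and> split_graph H \<and> switch_degree H = 4"
proof -
  from assms consider "H = D41" | "H = D22" | "H = R311" | "H = R331" | "H = R211" | "H = R321"
    by blast
  then show ?thesis
  proof cases
    case 1
    show ?thesis unfolding 1 D41_def by (rule two_list_degree_four) (auto simp: insert_Diff_if)
  next
    case 2
    show ?thesis unfolding 2 D22_def by (rule two_list_degree_four) (auto simp: insert_Diff_if)
  next
    case 3
    show ?thesis unfolding 3 R311_def by (rule three_list_degree_four) (auto simp: insert_Diff_if)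
  next
    case 4
    show ?thesis unfolding 4 R331_def by (rule three_list_degree_four) (auto simp: insert_Diff_if)
  next
    case 5
    show ?thesis unfolding 5 R211_def by (rule three_list_degree_four) (auto simp: insert_Diff_if)
  next
    case 6
    show ?thesis unfolding 6 R321_def by (rule three_list_degree_four) (auto simp: insert_Diff_if)
  qed
qed

lemma uncomplemented_orders_and_sizes:
  "(card (vertices D41), card (edges D41)) = (7, 15)"
  "(card (vertices D22), card (edges D22)) = (6, 10)"
  "(card (vertices R311), card (edges R311)) = (7, 11)"
  "(card (vertices R331), card (edges R331)) = (7, 13)"
  "(card (vertices R211), card (edges R211)) = (6, 7)"
  "(card (vertices R321), card (edges R321)) = (7, 12)"
  unfolding D41_def D22_def R311_def R331_def R211_def R321_def card_vertices_from_nbhds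
  by (subst card_edges_from_nbhds; force simp: choose_two lessThan_Suc)+

section \<open>Prime split graphs of degree four with few independent vertices\<close>

lemma nat_mult_eq_2_iff: "m * n = 2 \<longleftrightarrow> m = 1 \<and> n = 2 \<or> m = 2 \<and> n = (1::nat)"
proof
  assume mn: "m * n = 2"
  then have "m dvd 2" "n dvd 2" by (metis dvd_triv_left, metis dvd_triv_right)
  then have "m \<le> 2" "n \<le> 2" by (simp_all add: dvd_imp_le)
  then show "m = 1 \<and> n = 2 \<or> m = 2 \<and> n = 1" using mn by (auto simp: le_Suc_eq numeral_2_eq_2)
qed auto

text \<open>A weight of 4 would have to split as \<open>1 + 1 + 2\<close>. Then the four differences that belong to the
  pairs of weight 1 have size 1, and the sizes of the Venn regions force the differences of the third pair to
  have equal size, so that their product is not 2. The value 3 does occur, for three disjoint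
  singletons.\<close>

lemma triangle_weight_ne_4:
  assumes fin: "finite A" "finite B" "finite C"
    and inc: "\<not> A \<subseteq> B" "\<not> B \<subseteq> A" "\<not> A \<subseteq> C" "\<not> C \<subseteq> A" "\<not> B \<subseteq> C" "\<not> C \<subseteq> B"
  shows "card (A - B) * card (B - A) + card (A - C) * card (C - A) + card (B - C) * card (C - B) \<noteq> 4"
proof
  assume four: "card (A - B) * card (B - A) + card (A - C) * card (C - A) + card (B - C) * card (C - B) = 4"
  define p q r s t u where defs: "p = card (A - B - C)" "q = card (B - A - C)" "r = card (C - A - B)"
    "s = card (B \<inter> C - A)" "t = card (A \<inter> C - B)" "u = card (A \<inter> B - C)"
  have split: "card S = card T + card U" if "S = T \<union> U" "T \<inter> U = {}" "finite S" for S T U :: "'a set"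
    using that by (simp add: card_Un_disjoint)
  have cards: "card (A - B) = p + t" "card (B - A) = q + s" "card (A - C) = p + u"
    "card (C - A) = r + s" "card (B - C) = q + u" "card (C - B) = r + t"
    unfolding defs by (rule split; use fin in auto)+
  have "card (A - B) > 0" "card (B - A) > 0" "card (A - C) > 0" "card (C - A) > 0"
    "card (B - C) > 0" "card (C - B) > 0"
    using inc fin by (auto simp: card_gt_0_iff)
  then have pos: "(p + t) * (q + s) > 0" "(p + u) * (r + s) > 0" "(q + u) * (r + t) > 0"
    unfolding cards by simp_all
  have "(p + t) * (q + s) = 1 \<and> (p + u) * (r + s) = 1 \<and> (q + u) * (r + t) = 2
      \<or> (p + t) * (q + s) = 1 \<and> (p + u) * (r + s) = 2 \<and> (q + u) * (r + t) = 1
      \<or> (p + t) * (q + s) = 2 \<and> (p + u) * (r + s) = 1 \<and> (q + u) * (r + t) = 1"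
    using four[unfolded cards] pos by linarith
  then show False
  proof (elim disjE conjE)
    assume "(p + t) * (q + s) = 1" "(p + u) * (r + s) = 1" "(q + u) * (r + t) = 2"
    then show False unfolding nat_mult_eq_2_iff nat_mult_eq_1_iff by linarith
  next
    assume "(p + t) * (q + s) = 1" "(p + u) * (r + s) = 2" "(q + u) * (r + t) = 1"
    then show False unfolding nat_mult_eq_2_iff nat_mult_eq_1_iff by linarith
  next
    assume "(p + t) * (q + s) = 2" "(p + u) * (r + s) = 1" "(q + u) * (r + t) = 1"
    then show False unfolding nat_mult_eq_2_iff nat_mult_eq_1_iff by linarith
  qed
qed

lemma nat_mult_eq_4_cases:
  assumes "m * n = 4" "m \<le> (n::nat)"
  shows "m = 1 \<and> n = 4 \<or> m = 2 \<and> n = 2"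
proof -
  have "m < 3"
  proof (rule ccontr)
    assume "\<not> m < 3"
    then have "3 * 3 \<le> m * n" using assms(2) by (intro mult_le_mono) auto
    then show False using assms(1) by simp
  qed
  then consider "m = 0" | "m = 1" | "m = 2" by linarith
  then show ?thesis using assms by cases auto
qed

lemma split_two_rows:
  assumes G: "simple_graph G" and KI: "split_bipartition G K I"
    and I: "I = {a, b}" "a \<noteq> b" and part: "nbhd G a \<union> nbhd G b = K" "nbhd G a \<inter> nbhd G b = {}"
    and four: "card (nbhd G a) * card (nbhd G b) = 4" and le: "card (nbhd G a) \<le> card (nbhd G b)"
  shows "graph_iso G D41 \<or> graph_iso G D22"
proof -
  let ?A = "nbhd G a" and ?B = "nbhd G b"
  have fin: "finite ?A" "finite ?B" using split_finite(3)[OF G KI] I by auto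
  obtain xs where xs: "distinct xs" "set xs = ?A" using finite_distinct_list[OF fin(1)] by auto
  obtain ys where ys: "distinct ys" "set ys = ?B" using finite_distinct_list[OF fin(2)] by auto
  have len: "card ?A = length xs" "card ?B = length ys"
    using xs ys distinct_card by metis+
  have ks: "distinct (xs @ ys)" "set (xs @ ys) = K" using xs ys part by auto
  from nat_mult_eq_4_cases[OF four le] show ?thesis
  proof
    assume "card ?A = 1 \<and> card ?B = 4"
    then obtain k1 k2 k3 k4 k5 where xy: "xs = [k1]" "ys = [k2, k3, k4, k5]"
      unfolding len by (auto simp: length_Suc_conv numeral_eq_Suc)
    have "graph_iso G (split_from_nbhds (length (xs @ ys)) [{1}, {2, 3, 4, 5}])"
    proof (rule iso_split_from_nbhds[OF G KI _ _ ks, where us = "[a, b]"])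
      show "nbhd G ([a, b] ! i) = (\<lambda>j. (xs @ ys) ! (j - 1)) ` ([{1}, {2, 3, 4, 5}] ! i)"
        if "i < length [a, b]" for i
        using that by (auto simp: xs(2)[symmetric] ys(2)[symmetric] xy less_Suc_eq)
    qed (use I xy in auto)
    then show ?thesis by (simp add: xy D41_def numeral_eq_Suc)
  next
    assume "card ?A = 2 \<and> card ?B = 2"
    then obtain k1 k2 k3 k4 where xy: "xs = [k1, k2]" "ys = [k3, k4]"
      unfolding len by (auto simp: length_Suc_conv numeral_eq_Suc)
    have "graph_iso G (split_from_nbhds (length (xs @ ys)) [{1, 2}, {3, 4}])"
    proof (rule iso_split_from_nbhds[OF G KI _ _ ks, where us = "[a, b]"])
      show "nbhd G ([a, b] ! i) = (\<lambda>j. (xs @ ys) ! (j - 1)) ` ([{1, 2}, {3, 4}] ! i)"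
        if "i < length [a, b]" for i
        using that by (auto simp: xs(2)[symmetric] ys(2)[symmetric] xy less_Suc_eq)
    qed (use I xy in auto)
    then show ?thesis by (simp add: xy D22_def numeral_eq_Suc)
  qed
qed

text \<open>With \<open>N a \<subseteq> N c\<close>, the clique consists of the four disjoint regions \<open>ss = N a\<close>, \<open>ts = N b - N c\<close>,
  \<open>xs = N b \<inter> N c\<close> and \<open>ys = N c - N a - N b\<close>, and the weight is
  \<open>|ss| (|ts| + |xs|) + |ts| (|ss| + |ys|)\<close>. As \<open>ss\<close> and \<open>ts\<close> are nonempty, this equals 4 in exactly
  five ways.\<close>

lemma split_three_rows:
  assumes G: "simple_graph G" and KI: "split_bipartition G K I"
    and I: "I = {a, b, c}" "distinct [a, b, c]"
    and part: "nbhd G a \<union> nbhd G b \<union> nbhd G c = K" "nbhd G a \<inter> nbhd G b \<inter> nbhd G c = {}"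
    and ab: "incomparable (nbhd G) a b" and bc: "incomparable (nbhd G) b c"
    and ac: "nbhd G a \<subseteq> nbhd G c"
    and four: "crossing (nbhd G) a b + crossing (nbhd G) b c = 4"
  shows "graph_iso G R331 \<or> graph_iso G R311 \<or> graph_iso G R321 \<or> graph_iso G R211
    \<or> graph_iso G (graph_complement R211)"
proof -
  let ?A = "nbhd G a" and ?B = "nbhd G b" and ?C = "nbhd G c"
  have fin: "finite ?A" "finite ?B" "finite ?C" using split_finite(3)[OF G KI] I by auto
  obtain ss where ss: "distinct ss" "set ss = ?A" using finite_distinct_list fin(1) by auto
  obtain ts where ts: "distinct ts" "set ts = ?B - ?C"
    using finite_distinct_list[of "?B - ?C"] fin by auto
  obtain xs where xs: "distinct xs" "set xs = ?B \<inter> ?C"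
    using finite_distinct_list[of "?B \<inter> ?C"] fin by auto
  obtain ys where ys: "distinct ys" "set ys = ?C - ?A - ?B"
    using finite_distinct_list[of "?C - ?A - ?B"] fin by auto
  have AB: "?A \<inter> ?B = {}" using part(2) ac by auto
  have rows: "?A = set ss" "?B = set ts \<union> set xs" "?C = set ss \<union> set xs \<union> set ys"
    using ss ts xs ys ac AB by auto
  have ks: "distinct (ss @ ts @ xs @ ys)" "set (ss @ ts @ xs @ ys) = K"
    using ss ts xs ys ac AB part(1) by auto
  have "?A - ?B = set ss" "?B - ?A = set (ts @ xs)" "?B - ?C = set ts" "?C - ?B = set (ss @ ys)"
    using rows ks(1) by auto
  moreover have "distinct (ts @ xs)" "distinct (ss @ ys)" using ks(1) by auto
  ultimately have card: "card (?A - ?B) = length ss" "card (?B - ?A) = length (ts @ xs)"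
    "card (?B - ?C) = length ts" "card (?C - ?B) = length (ss @ ys)"
    using ss(1) ts(1) distinct_card by metis+
  have "length ss > 0" "length ts > 0"
    unfolding card[symmetric] using ab bc fin by (auto simp: incomparable_def card_gt_0_iff)
  then obtain s t where st: "length ss = Suc s" "length ts = Suc t" by (metis gr0_implies_Suc)
  have "(Suc s) * (Suc t + length xs) + (Suc t) * (Suc s + length ys) = 4"
    using four by (simp add: crossing_def card st)
  then have sum: "2 * (s * t + s + t) + (length xs + s * length xs) + (length ys + t * length ys) = 2"
    by (simp add: algebra_simps)
  have small: "s * t + s + t \<le> 1" "length xs + length ys \<le> 2" using sum by auto
  consider
      (x2) "length ss = 1" "length ts = 1" "length xs = 2" "length ys = 0"
    | (xy) "length ss = 1" "length ts = 1" "length xs = 1" "length ys = 1"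
    | (y2) "length ss = 1" "length ts = 1" "length xs = 0" "length ys = 2"
    | (s2) "length ss = 2" "length ts = 1" "length xs = 0" "length ys = 0"
    | (t2) "length ss = 1" "length ts = 2" "length xs = 0" "length ys = 0"
  proof -
    consider "s = 0" "t = 0" | "s = 1" "t = 0" | "s = 0" "t = 1" using small(1) by linarith
    then show ?thesis
    proof cases
      case 1
      then have "length xs + length ys = 2" using sum by simp
      then consider "length xs = 2" "length ys = 0" | "length xs = 1" "length ys = 1"
        | "length xs = 0" "length ys = 2" by linarith
      then show ?thesis using 1 st x2 xy y2 by cases auto
    next
      case 2
      then show ?thesis using sum st s2 by auto
    next
      case 3
      then show ?thesis using sum st t2 by auto
    qed
  qed
  then show ?thesis
  proof cases
    case x2
    then obtain k1 k2 k3 k4 where l: "ss = [k1]" "ts = [k2]" "xs = [k3, k4]" "ys = []"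
      by (auto simp: length_Suc_conv numeral_eq_Suc)
    have "graph_iso G (split_from_nbhds (length (ss @ ts @ xs @ ys)) [{1}, {2, 3, 4}, {1, 3, 4}])"
    proof (rule iso_split_from_nbhds[OF G KI _ _ ks, where us = "[a, b, c]"])
      show "nbhd G ([a, b, c] ! i) = (\<lambda>j. (ss @ ts @ xs @ ys) ! (j - 1)) ` ([{1}, {2, 3, 4}, {1, 3, 4}] ! i)"
        if "i < length [a, b, c]" for i
        using that by (auto simp: rows l less_Suc_eq)
    qed (use I l in auto)
    then show ?thesis by (simp add: l R331_def numeral_eq_Suc)
  next
    case xy
    then obtain k1 k2 k3 k4 where l: "ss = [k1]" "ts = [k2]" "xs = [k3]" "ys = [k4]"
      by (auto simp: length_Suc_conv numeral_eq_Suc)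
    have "graph_iso G (split_from_nbhds (length (ss @ ts @ xs @ ys)) [{1}, {2, 3}, {1, 3, 4}])"
    proof (rule iso_split_from_nbhds[OF G KI _ _ ks, where us = "[a, b, c]"])
      show "nbhd G ([a, b, c] ! i) = (\<lambda>j. (ss @ ts @ xs @ ys) ! (j - 1)) ` ([{1}, {2, 3}, {1, 3, 4}] ! i)"
        if "i < length [a, b, c]" for i
        using that by (auto simp: rows l less_Suc_eq)
    qed (use I l in auto)
    then show ?thesis by (simp add: l R321_def numeral_eq_Suc)
  next
    case y2
    then obtain k1 k2 k3 k4 where l: "ss = [k1]" "ts = [k2]" "xs = []" "ys = [k3, k4]"
      by (auto simp: length_Suc_conv numeral_eq_Suc)
    have "graph_iso G (split_from_nbhds (length (ss @ ts @ xs @ ys)) [{1}, {2}, {1, 3, 4}])"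
    proof (rule iso_split_from_nbhds[OF G KI _ _ ks, where us = "[a, b, c]"])
      show "nbhd G ([a, b, c] ! i) = (\<lambda>j. (ss @ ts @ xs @ ys) ! (j - 1)) ` ([{1}, {2}, {1, 3, 4}] ! i)"
        if "i < length [a, b, c]" for i
        using that by (auto simp: rows l less_Suc_eq)
    qed (use I l in auto)
    then show ?thesis by (simp add: l R311_def numeral_eq_Suc)
  next
    case t2
    then obtain k1 k2 k3 where l: "ss = [k1]" "ts = [k2, k3]" "xs = []" "ys = []"
      by (auto simp: length_Suc_conv numeral_eq_Suc)
    have "graph_iso G (split_from_nbhds (length (ss @ ts @ xs @ ys)) [{1}, {2, 3}, {1}])"
    proof (rule iso_split_from_nbhds[OF G KI _ _ ks, where us = "[a, b, c]"])
      show "nbhd G ([a, b, c] ! i) = (\<lambda>j. (ss @ ts @ xs @ ys) ! (j - 1)) ` ([{1}, {2, 3}, {1}] ! i)"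
        if "i < length [a, b, c]" for i
        using that by (auto simp: rows l less_Suc_eq)
    qed (use I l in auto)
    then show ?thesis by (simp add: l R211_def numeral_eq_Suc)
  next
    case s2
    then obtain k1 k2 k3 where l: "ss = [k1, k2]" "ts = [k3]" "xs = []" "ys = []"
      by (auto simp: length_Suc_conv numeral_eq_Suc)
    have dk: "k1 \<noteq> k2" "k1 \<noteq> k3" "k2 \<noteq> k3" "K = {k1, k2, k3}" using ks by (auto simp: l)
    \<comment> \<open>Here \<open>N a = N c\<close> has two elements and \<open>N b\<close> one; in the complement the roles of the two sides
      are exchanged and the pattern of \<open>R211\<close> appears.\<close>
    have nb: "nbhd (graph_complement G) k1 = {b}" "nbhd (graph_complement G) k2 = {b}"
      "nbhd (graph_complement G) k3 = {a, c}"
      using I dk by (auto simp: nbhd_complement[OF G KI] rows l)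
    have "graph_iso (graph_complement G) (split_from_nbhds (length [b, a, c]) [{1}, {2, 3}, {1}])"
    proof (rule iso_split_from_nbhds[OF simple_complement[OF G] split_bipartition_complement[OF G KI],
          where us = "[k1, k3, k2]"])
      show "nbhd (graph_complement G) ([k1, k3, k2] ! i)
          = (\<lambda>j. [b, a, c] ! (j - 1)) ` ([{1}, {2, 3}, {1}] ! i)"
        if "i < length [k1, k3, k2]" for i
        using that nb by (auto simp: less_Suc_eq)
    qed (use I dk in auto)
    then have "graph_iso (graph_complement G) R211" by (simp add: R211_def numeral_eq_Suc)
    from graph_iso_complement[OF this] show ?thesis by (simp add: complement_complement[OF G])
  qed
qed

text \<open>For two rows, no element of \<open>K\<close> lies in both, so the rows partition \<open>K\<close>. For three rows, a vertex
  incomparable to both others can be chosen as the middle one; the outer two are then comparable, as a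
  triangle is excluded, and by symmetry either may be the smaller.\<close>

lemma few_rows_classification:
  assumes G: "simple_graph G" and KI: "split_bipartition G K I" and prime: "prime_graph G"
    and deg: "switch_degree G = 4" and I3: "card I \<le> 3"
  shows "\<exists>H \<in> set degree_four_graphs. graph_iso G H"
proof -
  let ?N = "nbhd G"
  note P = prime_split_imp[OF G KI prime]
  have NK: "?N u \<subseteq> K" if "u \<in> I" for u using split_nbhd_subset[OF G KI that] .
  note fin = split_finite(3)[OF G KI]
  have total: "(\<Sum>u\<in>I. \<Sum>v\<in>I. crossing ?N u v) = 8"
    using split_switch_degree[OF G KI] deg by simp
  have partner: "\<exists>v\<in>I. v \<noteq> u \<and> incomparable ?N u v" if u: "u \<in> I" for u
  proof -
    have "{u} \<subset> I" using P(1) u by auto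
    then show ?thesis using P(3)[unfolded linked_def, rule_format, of "{u}"] by auto
  qed
  have "card I = 2 \<or> card I = 3" using P(1) I3 by linarith
  then show ?thesis
  proof
    assume "card I = 2"
    then obtain a b where I: "I = {a, b}" "a \<noteq> b" by (auto simp: card_2_iff)
    have sep: "(?N a \<union> ?N b) - (?N a \<inter> ?N b) = K" using P(2) I by (simp add: separated_def)
    then have part: "?N a \<union> ?N b = K" "?N a \<inter> ?N b = {}" using NK I by auto
    have "card (?N a) * card (?N b) = 4"
    proof -
      have "?N a - ?N b = ?N a" "?N b - ?N a = ?N b" using part(2) by auto
      then show ?thesis using total I(2) by (simp add: I(1) crossing_def mult.commute)
    qed
    then have four: "card (?N a) * card (?N b) = 4" "card (?N b) * card (?N a) = 4"
      by (simp_all add: mult.commute)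
    have swap: "I = {b, a}" "b \<noteq> a" "?N b \<union> ?N a = K" "?N b \<inter> ?N a = {}"
      using I part by auto
    have "graph_iso G D41 \<or> graph_iso G D22"
      using split_two_rows[OF G KI I part four(1)] split_two_rows[OF G KI swap four(2)]
      by linarith
    then show ?thesis by (auto simp: degree_four_graphs_def)
  next
    assume "card I = 3"
    have path: ?thesis if I: "I = {a, b, c}" "distinct [a, b, c]"
      and ab: "incomparable ?N a b" and bc: "incomparable ?N b c" for a b c
    proof -
      have sep: "(?N a \<union> ?N b \<union> ?N c) - (?N a \<inter> ?N b \<inter> ?N c) = K"
        using P(2) I(1) by (simp add: separated_def Un_assoc Int_assoc)
      then have part: "?N a \<union> ?N b \<union> ?N c = K" "?N a \<inter> ?N b \<inter> ?N c = {}" using NK I by auto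
      have sum: "crossing ?N a b + crossing ?N a c + crossing ?N b c = 4"
        using total I(2)
        by (simp add: I(1) crossing_sym[of ?N b a] crossing_sym[of ?N c a] crossing_sym[of ?N c b])
      have fin3: "finite (?N a)" "finite (?N b)" "finite (?N c)" using fin I(1) by auto
      have "\<not> incomparable ?N a c"
        using triangle_weight_ne_4[OF fin3] sum ab bc by (auto simp: incomparable_def crossing_def)
      then have ac: "crossing ?N a c = 0" "?N a \<subseteq> ?N c \<or> ?N c \<subseteq> ?N a"
        using crossing_eq_0_iff[of ?N a c] fin3 by (auto simp: incomparable_def)
      have "graph_iso G R331 \<or> graph_iso G R311 \<or> graph_iso G R321 \<or> graph_iso G R211
        \<or> graph_iso G (graph_complement R211)"
        using ac(2)
      proof
        assume sub: "?N a \<subseteq> ?N c"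
        show ?thesis
          by (rule split_three_rows[OF G KI I part ab bc sub]) (use sum ac in simp)
      next
        assume sub: "?N c \<subseteq> ?N a"
        have "I = {c, b, a}" "distinct [c, b, a]" "?N c \<union> ?N b \<union> ?N a = K" "?N c \<inter> ?N b \<inter> ?N a = {}"
          using I part by auto
        moreover have "crossing ?N c b + crossing ?N b a = 4"
          using sum ac by (simp add: crossing_sym[of ?N c b] crossing_sym[of ?N b a])
        ultimately show ?thesis
          using split_three_rows[OF G KI _ _ _ _ incomparable_sym[OF bc] incomparable_sym[OF ab] sub]
          by blast
      qed
      then show ?thesis by (auto simp: degree_four_graphs_def)
    qed
    \<comment> \<open>Every vertex has an incomparable partner, which on three vertices forces a path.\<close>
    obtain x y z where I: "I = {x, y, z}" "distinct [x, y, z]"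
      using \<open>card I = 3\<close> by (auto simp: card_3_iff)
    have "\<exists>a b c. I = {a, b, c} \<and> distinct [a, b, c] \<and> incomparable ?N a b \<and> incomparable ?N b c"
    proof -
      obtain y' where y': "y' \<in> I" "y' \<noteq> x" "incomparable ?N x y'" using partner[of x] I by auto
      then obtain z' where z': "I = {x, y', z'}" "distinct [x, y', z']" using I by auto
      obtain w where w: "w \<in> I" "w \<noteq> z'" "incomparable ?N z' w" using partner[of z'] z' by auto
      show ?thesis
      proof (cases "w = y'")
        case True
        then show ?thesis using z' y' w incomparable_sym by metis
      next
        case False
        then have "w = x" using w z' by auto
        moreover have "I = {z', x, y'}" "distinct [z', x, y']" using z' by auto
        ultimately show ?thesis using y' w by metis
      qed
    qed
    then show ?thesis using path by metis
  qed
qed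

section \<open>The classification\<close>

text \<open>This invariant alone separates the twelve graphs.\<close>

definition order_and_size :: "'a sgraph \<Rightarrow> nat \<times> nat" where
  "order_and_size G = (card (vertices G), card (edges G))"

text \<open>The classification reduces to \<open>|I| \<le> 3\<close> by complementation, and therefore needs a list that is
  closed under it.\<close>

lemma degree_four_graphs_complement:
  assumes "H \<in> set degree_four_graphs"
  shows "graph_complement H \<in> set degree_four_graphs"
proof -
  have "graph_complement (graph_complement H) = H" if "H \<in> uncomplemented" for H
    using uncomplemented_degree_four[OF that] complement_complement by blast
  then show ?thesis using assms by (auto simp: degree_four_graphs_def)
qed

lemma degree_four_graphs_sound:
  assumes "H \<in> set degree_four_graphs"
  shows "simple_graph H \<and> prime_graph H \<and> split_graph H \<and> switch_degree H = 4"
proof -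
  let ?P = "\<lambda>H :: (nat + nat) sgraph. simple_graph H \<and> prime_graph H \<and> split_graph H \<and> switch_degree H = 4"
  have half: "?P H \<and> ?P (graph_complement H)" if "H \<in> uncomplemented" for H
    using uncomplemented_degree_four[OF that]
    by (simp add: simple_complement prime_complement split_complement switch_degree_complement)
  have "\<exists>H' \<in> uncomplemented. H = H' \<or> H = graph_complement H'"
    using assms by (auto simp: degree_four_graphs_def)
  then show ?thesis using half by metis
qed

lemma order_and_size_complement:
  assumes "simple_graph G" "order_and_size G = (n, m)"
  shows "order_and_size (graph_complement G) = (n, (n choose 2) - m)"
  using assms by (simp add: order_and_size_def card_edges_complement)

lemma orders_and_sizes:
  "map order_and_size degree_four_graphs =
     [(7, 15), (7, 6), (6, 10), (6, 5), (7, 11), (7, 10), (7, 13), (7, 8), (6, 7), (6, 8), (7, 12), (7, 9)]"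
proof -
  have simple: "simple_graph H" if "H \<in> uncomplemented" for H
    using uncomplemented_degree_four[OF that] by blast
  note os = uncomplemented_orders_and_sizes[folded order_and_size_def]
  show ?thesis
    unfolding degree_four_graphs_def
    by (simp add: os os[THEN order_and_size_complement[OF simple, rotated]] choose_two)
qed

lemma degree_four_graphs_not_iso: "sorted_wrt (\<lambda>H H'. \<not> graph_iso H H') degree_four_graphs"
proof -
  let ?L = degree_four_graphs
  have d: "distinct (map order_and_size ?L)" unfolding orders_and_sizes by simp
  have "\<not> graph_iso (?L ! i) (?L ! j)" if "i < j" "j < length ?L" for i j
  proof
    assume "graph_iso (?L ! i) (?L ! j)"
    then have "order_and_size (?L ! i) = order_and_size (?L ! j)"
      using graph_iso_card[of "?L ! i" "?L ! j"] degree_four_graphs_sound that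
      by (simp add: order_and_size_def)
    then show False using d that by (simp add: distinct_conv_nth)
  qed
  then show ?thesis by (simp add: sorted_wrt_iff_nth_less)
qed

lemma prime_split_order_bound:
  assumes G: "simple_graph G" and KI: "split_bipartition G K I" and prime: "prime_graph G"
  shows "card I + card K \<le> switch_degree G + 3"
  using linked_order_bound[OF prime_split_imp(3)[OF assms] split_finite(2)[OF G KI]
      prime_split_imp(1)[OF assms] split_finite(3)[OF G KI]]
  unfolding split_switch_degree[OF G KI, symmetric] prime_split_imp(2)[OF assms] by simp

text \<open>The two sides together have at most 7 vertices, so one of them has at most 3; if it is the clique,
  pass to the complement.\<close>

lemma degree_four_classification:
  assumes G: "simple_graph G" and prime: "prime_graph G" and split: "split_graph G"
    and four: "switch_degree G = 4"
  shows "\<exists>H \<in> set degree_four_graphs. graph_iso G H"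
proof -
  obtain K I where KI: "split_bipartition G K I" using split by (auto simp: split_graph_def)
  have "card I + card K \<le> 7" using prime_split_order_bound[OF G KI prime] four by simp
  then consider "card I \<le> 3" | "card K \<le> 3" by linarith
  then show ?thesis
  proof cases
    case 1
    then show ?thesis using few_rows_classification[OF G KI prime four] by blast
  next
    case 2
    have "prime_graph (graph_complement G)" "switch_degree (graph_complement G) = 4"
      using prime four by (simp_all add: prime_complement[OF G] switch_degree_complement)
    then obtain H where H: "H \<in> set degree_four_graphs" "graph_iso (graph_complement G) H"
      using few_rows_classification[OF simple_complement[OF G] split_bipartition_complement[OF G KI]] 2
      by blast
    from graph_iso_complement[OF H(2)] have "graph_iso G (graph_complement H)"
      by (simp add: complement_complement[OF G])
    then show ?thesis using degree_four_graphs_complement[OF H(1)] by blast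
  qed
qed

theorem theorem5p1:
  "(\<forall>G :: 'a sgraph. simple_graph G \<longrightarrow>
      (prime_graph G \<and> split_graph G \<and> switch_degree G = 4
        \<longleftrightarrow> (\<exists>H \<in> set degree_four_graphs. graph_iso G H)))
   \<and> (\<forall>H \<in> set degree_four_graphs.
        simple_graph H \<and> prime_graph H \<and> split_graph H \<and> switch_degree H = 4)
   \<and> sorted_wrt (\<lambda>H H'. \<not> graph_iso H H') degree_four_graphs"
proof (intro conjI allI impI)
  fix G :: "'a sgraph" assume G: "simple_graph G"
  show "prime_graph G \<and> split_graph G \<and> switch_degree G = 4
      \<longleftrightarrow> (\<exists>H \<in> set degree_four_graphs. graph_iso G H)" (is "?L \<longleftrightarrow> ?R")
  proof
    show ?R if ?L using that degree_four_classification[OF G] by blast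
  next
    assume ?R
    then obtain H where H: "H \<in> set degree_four_graphs" "graph_iso G H" by blast
    note S = degree_four_graphs_sound[OF H(1)]
    show ?L using graph_iso_prime_split[OF G _ H(2)] S by simp
  qed
next
  show "\<forall>H \<in> set degree_four_graphs.
      simple_graph H \<and> prime_graph H \<and> split_graph H \<and> switch_degree H = 4"
    using degree_four_graphs_sound by blast
  show "sorted_wrt (\<lambda>H H'. \<not> graph_iso H H') degree_four_graphs"
    by (rule degree_four_graphs_not_iso)
qed

end
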